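(* For an integer $k\ge 0$ write $(\tfrac12)_k:=\left|\binom{-1/2}{k}\right|$. Define $$\nu:=\frac{1}{\pi}\sum{}^{'}\frac{(\frac{1}{2})_{k_{1}}(\frac{1}{2})_{k_{2}}(\frac{1}{2})_{a}(\frac{1}{2})_{b}}{(b-a+\frac{1}{2})(b+k_{1}+\frac{1}{2})(a+k_{1})(a+k_{2})},$$ $$\nu':=\frac{1}{\pi}\sum{}^{'}\frac{(\frac{1}{2})_{k_{1}}(\frac{1}{2})_{k_{2}}(\frac{1}{2})_{a}(\frac{1}{2})_{b}}{(b-a+\frac{1}{2})(b+k_{1}+\frac{1}{2})(b+k_{2}+\frac{1}{2})(a+k_{1})},$$ $$\psi:=\frac{1}{\pi}\sum{}^{'}\frac{(\frac{1}{2})_{a}(\frac{1}{2})_{b}}{(b+\frac{1}{2})\,a^{2}\,(a+b+\frac{1}{2})},$$ where $\sum{}^{'}$ denotes summation over all tuples of non-negative integers ($(k_1,k_2,a,b)$ for $\nu,\nu'$, and $(a,b)$ for $\psi$) for which the denominator is nonzero. Then, with $\gamma_1:=\log 4$, $$\nu+\nu'-\psi=\frac{8}{3}\gamma_{1}^{3}+2\gamma_{1}\zeta(2)-12\,\zeta(3).$$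
   Context: $\zeta$ is the Riemann zeta function. Note the non-standard use of the symbol $(\tfrac12)_k$: it means $\left|\binom{-1/2}{k}\right|=\frac{1\cdot3\cdots(2k-1)}{2^k\,k!}$, i.e. the coefficient of $x^k$ in $(1-x)^{-1/2}$ (so it includes division by $k!$). *)

theory Defs
  imports "HOL-Analysis.Analysis"
begin

(* The coefficient of x^k in (1 - x)^(-1/2).  Unlike pochhammer (1/2) k, it includes the
   division by k!. *)
definition half_coeff :: "nat \<Rightarrow> real" where
  "half_coeff k = \<bar>(- 1/2) gchoose k\<bar>"

(* The Dirichlet series, which is the Riemann zeta function for real s > 1. *)
definition zeta :: "real \<Rightarrow> real" where
  "zeta s = (\<Sum>n. 1 / real (Suc n) powr s)"

(* In each primed sum, numerator and denominator are kept apart because the range of summation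
   is the set of index tuples with nonzero denominator.  The sums are unordered sums of reals
   (equivalently, absolutely convergent ones). *)

definition coeff4 :: "nat \<times> nat \<times> nat \<times> nat \<Rightarrow> real" where
  "coeff4 = (\<lambda>(k1, k2, a, b). half_coeff k1 * half_coeff k2 * half_coeff a * half_coeff b)"

definition nu_denom :: "nat \<times> nat \<times> nat \<times> nat \<Rightarrow> real" where
  "nu_denom = (\<lambda>(k1, k2, a, b).
     (real b - real a + 1/2) * (real b + real k1 + 1/2) * (real a + real k1) * (real a + real k2))"

definition nu'_denom :: "nat \<times> nat \<times> nat \<times> nat \<Rightarrow> real" where
  "nu'_denom = (\<lambda>(k1, k2, a, b).
     (real b - real a + 1/2) * (real b + real k1 + 1/2) * (real b + real k2 + 1/2) * (real a + real k1))"

definition coeff2 :: "nat \<times> nat \<Rightarrow> real" where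
  "coeff2 = (\<lambda>(a, b). half_coeff a * half_coeff b)"

definition psi_denom :: "nat \<times> nat \<Rightarrow> real" where
  "psi_denom = (\<lambda>(a, b). (real b + 1/2) * (real a)\<^sup>2 * (real a + real b + 1/2))"

definition nu :: real where
  "nu = 1 / pi * (\<Sum>\<^sub>\<infinity>t\<in>{t. nu_denom t \<noteq> 0}. coeff4 t / nu_denom t)"

definition nu' :: real where
  "nu' = 1 / pi * (\<Sum>\<^sub>\<infinity>t\<in>{t. nu'_denom t \<noteq> 0}. coeff4 t / nu'_denom t)"

definition psi :: real where
  "psi = 1 / pi * (\<Sum>\<^sub>\<infinity>t\<in>{t. psi_denom t \<noteq> 0}. coeff2 t / psi_denom t)"

definition gamma1 :: real where
  "gamma1 = ln 4"

end

theory Submission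
  imports Defs
begin

text \<open>
  Write \<open>c k\<close> for \<open>half_coeff k\<close>.  Summing out \<open>k1\<close> and \<open>k2\<close> uses the values of
  \<open>F(z) = \<Sum>k. c k / (k + z)\<close> at integers and half-integers, which follow from
  \<open>(z + 1/2) F(z + 1) = z F(z)\<close> and Wallis' product.  The same recurrence shows that the logarithmic
  derivative of \<open>F\<close> and its derivatives telescope; at \<open>z = 1/2\<close> and \<open>z = 1\<close> they give
  \<open>log 4\<close>, \<open>\<zeta>(2)\<close> and \<open>\<zeta>(3)\<close>.  What remains are two double series with
  denominator \<open>(b - a + 1/2)\<^sup>2\<close>.  Each collapses to a single series, and their difference is,
  up to a factor \<open>\<pi>\<close>,
  \<open>\<pi>\<^sup>2 \<Sum>b. (c b)\<^sup>2 / (b + 1/2) - \<Sum>a\<ge>1. 1 / (a\<^sup>3 (c a)\<^sup>2)\<close>.  Its two terms are sums of one function of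
  \<open>x\<close>, over \<open>x = b\<close> and over \<open>x = a - 1/2\<close>, so one Wilf--Zeilberger pair evaluates it as
  \<open>\<Sum>n. 2 / (n + 1/2)\<^sup>3 = 14 \<zeta>(3)\<close>.
\<close>

subsection \<open>The coefficients of the inverse square root\<close>

lemma half_coeff_0 [simp]: "half_coeff 0 = 1"
  by (simp add: half_coeff_def)

text \<open>The two absorption identities give the signed ratio
  \<open>(- 1/2 - k) / (k + 1)\<close>; the absolute value removes its sign.\<close>

lemma half_coeff_Suc: "half_coeff (Suc k) = half_coeff k * ((real k + 1/2) / (real k + 1))"
proof -
  have "(- 1/2 :: real) gchoose Suc k = ((- 1/2) gchoose k) * ((- 1/2 - real k) / (real k + 1))"
    using gbinomial_absorb_comp[of "- 1/2 :: real" k] gbinomial_absorption[of k "- 1/2 :: real"]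
    by (simp add: field_simps)
  moreover have "\<bar>(- 1/2 - real k) / (real k + 1)\<bar> = (real k + 1/2) / (real k + 1)"
    by (simp add: abs_divide)
  ultimately show ?thesis
    unfolding half_coeff_def by (simp only: abs_mult)
qed

lemma half_coeff_pos [simp]: "half_coeff k > 0"
  by (induction k) (auto simp: half_coeff_Suc add_nonneg_pos)

lemma half_coeff_nonneg [simp]: "half_coeff k \<ge> 0"
  using half_coeff_pos[of k] by linarith

lemma half_coeff_neq_0 [simp]: "half_coeff k \<noteq> 0"
  using half_coeff_pos[of k] by linarith

lemma Suc_times_half_coeff_Suc:
  "(real k + 1) * half_coeff (Suc k) = (real k + 1/2) * half_coeff k"
  by (simp add: half_coeff_Suc)

text \<open>The induction step amounts to
  \<open>(k + 1/2)^2 * (k + 2) \<le> (k + 1)^3\<close>.\<close>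

lemma half_coeff_sq_le: "(half_coeff k)\<^sup>2 \<le> 1 / (real k + 1)"
proof (induction k)
  case (Suc k)
  have "(half_coeff (Suc k))\<^sup>2 = (half_coeff k)\<^sup>2 * ((real k + 1/2) / (real k + 1))\<^sup>2"
    by (simp add: half_coeff_Suc power_mult_distrib power_divide)
  also have "\<dots> \<le> 1 / (real k + 1) * ((real k + 1/2) / (real k + 1))\<^sup>2"
    by (intro mult_right_mono Suc) auto
  also have "\<dots> \<le> 1 / (real (Suc k) + 1)"
    by (simp add: divide_simps power2_eq_square) (simp add: algebra_simps)
  finally show ?case .
qed simp

text \<open>With \<open>n = k + 1\<close> the bound reads \<open>1 / (4 n)\<close>, and it is an
  equality at \<open>n = 1\<close>. It later bounds reciprocals of squared coefficients.\<close>

lemma half_coeff_sq_ge: "(half_coeff (Suc k))\<^sup>2 \<ge> 1 / (4 * (real k + 1))"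
proof (induction k)
  case 0
  show ?case by (simp add: half_coeff_Suc power2_eq_square)
next
  case (Suc k)
  have "1 / (4 * (real (Suc k) + 1)) \<le>
      1 / (4 * (real k + 1)) * ((real (Suc k) + 1/2) / (real (Suc k) + 1))\<^sup>2"
    by (simp add: divide_simps power2_eq_square) (simp add: algebra_simps)
  also have "\<dots> \<le> (half_coeff (Suc k))\<^sup>2 * ((real (Suc k) + 1/2) / (real (Suc k) + 1))\<^sup>2"
    by (intro mult_right_mono Suc) auto
  also have "\<dots> = (half_coeff (Suc (Suc k)))\<^sup>2"
    by (simp add: half_coeff_Suc[of "Suc k"] power_mult_distrib power_divide)
  finally show ?case .
qed

lemma half_coeff_tendsto_0: "half_coeff \<longlonglongrightarrow> 0"
proof -
  have "(\<lambda>k. (half_coeff k)\<^sup>2) \<longlonglongrightarrow> 0"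
  proof (rule tendsto_sandwich[where f = "\<lambda>_. 0"])
    show "(\<lambda>k. 1 / (real k + 1)) \<longlonglongrightarrow> 0"
      using LIMSEQ_inverse_real_of_nat by (simp add: inverse_eq_divide add.commute)
    show "\<forall>\<^sub>F k in sequentially. (half_coeff k)\<^sup>2 \<le> 1 / (real k + 1)"
      by (simp add: half_coeff_sq_le)
  qed auto
  from tendsto_real_sqrt[OF this] show ?thesis by simp
qed

text \<open>The partial Wallis products equal \<open>1 / ((2 n + 1) * (half_coeff n)^2)\<close>;
  passing from \<open>n + 1/2\<close> to \<open>n\<close> costs half a squared coefficient, which
  tends to 0.\<close>

lemma half_coeff_wallis: "(\<lambda>n. real n * (half_coeff n)\<^sup>2) \<longlonglongrightarrow> 1 / pi"
proof -
  have prod: "(\<Prod>k=1..n. (4*real k^2) / (4*real k^2 - 1)) = 1 / ((2 * real n + 1) * (half_coeff n)\<^sup>2)" for n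
  proof (induction n)
    case (Suc n)
    have "(4*real (Suc n)^2) / (4*real (Suc n)^2 - 1) =
        (2 * real n + 1) / (2 * real n + 3) * ((real n + 1) / (real n + 1/2))\<^sup>2"
    proof -
      have nz: "4 * real (Suc n)^2 - 1 = (2 * real n + 1) * (2 * real n + 3)"
        by (simp add: power2_eq_square algebra_simps)
      show ?thesis
        unfolding nz by (simp add: divide_simps power2_eq_square) (simp add: algebra_simps)
    qed
    then have "(\<Prod>k=1..Suc n. (4*real k^2) / (4*real k^2 - 1)) =
        1 / ((2 * real n + 1) * (half_coeff n)\<^sup>2) *
        ((2 * real n + 1) / (2 * real n + 3) * ((real n + 1) / (real n + 1/2))\<^sup>2)"
      using Suc by simp
    also have "\<dots> = 1 / ((2 * real n + 3) * (half_coeff (Suc n))\<^sup>2)"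
    proof -
      have "1 / ((2 * m + 1) * h\<^sup>2) * ((2 * m + 1) / (2 * m + 3) * ((m + 1) / (m + 1/2))\<^sup>2) =
          1 / ((2 * m + 3) * (h * ((m + 1/2) / (m + 1)))\<^sup>2)"
        if "m \<ge> 0" "h > 0" for m h :: real
        using that by (simp add: power_mult_distrib power_divide)
      from this[of "real n" "half_coeff n"] show ?thesis
        by (simp add: half_coeff_Suc)
    qed
    finally show ?case by (simp add: algebra_simps)
  qed simp
  have lim: "(\<lambda>n. 1 / ((2 * real n + 1) * (half_coeff n)\<^sup>2)) \<longlonglongrightarrow> pi / 2"
    using wallis unfolding prod .
  have eq: "real n * (half_coeff n)\<^sup>2 =
      1 / (2 * (1 / ((2 * real n + 1) * (half_coeff n)\<^sup>2))) - (half_coeff n)\<^sup>2 / 2" for n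
    by (simp add: field_simps)
  have "(\<lambda>n. 1 / (2 * (1 / ((2 * real n + 1) * (half_coeff n)\<^sup>2))) - (half_coeff n)\<^sup>2 / 2)
      \<longlonglongrightarrow> 1 / (2 * (pi / 2)) - 0\<^sup>2 / 2"
    by (intro tendsto_intros lim half_coeff_tendsto_0) auto
  then show ?thesis
    unfolding eq by simp
qed

subsection \<open>Sums of the coefficients over powers of a linear term\<close>

text \<open>For \<open>z > 0\<close>, \<open>hsum 1 z\<close> is the Beta integral B(z, 1/2), and
  \<open>hsum (n + 1)\<close> is its n-th derivative times \<open>(-1)^n / n!\<close>. For
  \<open>n \<ge> 1\<close> a term with \<open>k + z = 0\<close> counts as 0.\<close>

definition hsum :: "nat \<Rightarrow> real \<Rightarrow> real" where
  "hsum n z = (\<Sum>k. half_coeff k / (real k + z) ^ n)"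

text \<open>The terms are the differences \<open>2 * half_coeff k - 2 * half_coeff (k + 1)\<close>.
  This series is the majorant for every \<open>hsum\<close> and supplies
  \<open>hsum 1 1\<close>.\<close>

lemma half_coeff_over_Suc_sums: "(\<lambda>k. half_coeff k / (real k + 1)) sums 2"
proof -
  have "(\<lambda>k. 2 * half_coeff k - 2 * half_coeff (Suc k)) sums (2 * half_coeff 0 - 2 * 0)"
    by (intro telescope_sums' tendsto_intros half_coeff_tendsto_0)
  moreover have "2 * half_coeff k - 2 * half_coeff (Suc k) = half_coeff k / (real k + 1)" for k
    by (simp add: half_coeff_Suc field_simps)
  ultimately show ?thesis by simp
qed

lemma hsum_sums:
  assumes "n \<ge> 1"
  shows "(\<lambda>k. half_coeff k / (real k + z) ^ n) sums hsum n z"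
proof -
  have "summable (\<lambda>k. half_coeff k / (real k + z) ^ n)"
  proof (rule summable_comparison_test_ev)
    show "summable (\<lambda>k. 2 * (half_coeff k / (real k + 1)))"
      using half_coeff_over_Suc_sums by (intro summable_mult) (simp add: sums_iff)
    have "norm (half_coeff k / (real k + z) ^ n) \<le> 2 * (half_coeff k / (real k + 1))"
      if k: "real k \<ge> 2 * \<bar>z\<bar> + 2" for k
    proof -
      have "real k \<ge> 2 * (- z) + 2"
        using k abs_ge_minus_self[of z] by linarith
      moreover have "real k \<ge> 0"
        by simp
      \<comment> \<open>The second bound makes powers of \<open>k + z\<close> increase with the
        exponent, so the first one suffices for every \<open>n \<ge> 1\<close>.\<close>
      ultimately have 1: "real k + z \<ge> (real k + 1) / 2" "real k + z \<ge> 1"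
        by (auto simp: field_simps)
      have "(real k + z) ^ 1 \<le> (real k + z) ^ n"
        using 1 assms by (intro power_increasing) auto
      hence "(real k + 1) / 2 \<le> (real k + z) ^ n"
        using 1 by simp
      hence "half_coeff k / (real k + z) ^ n \<le> half_coeff k / ((real k + 1) / 2)"
        by (intro divide_left_mono) (auto intro!: mult_pos_pos simp: zero_less_power 1 less_le_trans[OF _ 1(2)])
      moreover have "(real k + z) ^ n > 0"
        using 1 by (intro zero_less_power) auto
      ultimately show ?thesis by (simp add: mult.commute)
    qed
    moreover have "\<forall>\<^sub>F k in sequentially. real k \<ge> 2 * \<bar>z\<bar> + 2"
      using filterlim_real_sequentially by (simp add: filterlim_at_top)
    ultimately show "\<forall>\<^sub>F k in sequentially.
        norm (half_coeff k / (real k + z) ^ n) \<le> 2 * (half_coeff k / (real k + 1))"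
      by (auto elim!: eventually_mono)
  qed
  then show ?thesis
    unfolding hsum_def by (rule summable_sums)
qed

lemma hsum_1_sums: "(\<lambda>k. half_coeff k / (real k + z)) sums hsum 1 z"
  using hsum_sums[of 1 z] by simp

lemma hsum_pos:
  assumes "n \<ge> 1" "z > 0"
  shows "hsum n z > 0"
proof -
  have "0 < (\<Sum>k. half_coeff k / (real k + z) ^ n)"
    using hsum_sums[OF assms(1), of z] assms(2)
    by (intro suminf_pos) (auto simp: sums_iff add_nonneg_pos)
  then show ?thesis by (simp add: hsum_def)
qed

lemma hsum_antimono:
  assumes "n \<ge> 1" "0 < z" "z \<le> w"
  shows "hsum n w \<le> hsum n z"
  unfolding hsum_def
proof (rule suminf_le)
  fix k
  show "half_coeff k / (real k + w) ^ n \<le> half_coeff k / (real k + z) ^ n"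
    using assms by (intro divide_left_mono power_mono mult_pos_pos zero_less_power) auto
qed (use hsum_sums[OF assms(1)] in \<open>auto simp: sums_iff\<close>)

lemma hsum_Suc_le:
  assumes "n \<ge> 1" "z > 0"
  shows "hsum (Suc n) z \<le> hsum n z / z"
proof (rule sums_le)
  show "(\<lambda>k. half_coeff k / (real k + z) ^ Suc n) sums hsum (Suc n) z"
    by (rule hsum_sums) simp
  show "(\<lambda>k. half_coeff k / (real k + z) ^ n / z) sums (hsum n z / z)"
    by (intro sums_divide hsum_sums assms)
  fix k
  have "half_coeff k / (real k + z) ^ n / (real k + z) \<le> half_coeff k / (real k + z) ^ n / z"
    using assms by (intro divide_left_mono divide_nonneg_pos mult_pos_pos) auto
  then show "half_coeff k / (real k + z) ^ Suc n \<le> half_coeff k / (real k + z) ^ n / z"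
    by (simp add: mult.commute)
qed

text \<open>For \<open>z > 0\<close> this is the functional equation of B(z, 1/2). The telescoping
  argument also covers negative half-integers, where the integral diverges.\<close>

lemma hsum_1_rec:
  assumes "\<And>k. real k + z \<noteq> 0"
  shows "(z + 1/2) * hsum 1 (z + 1) = z * hsum 1 z"
proof -
  \<comment> \<open>Splitting off the pole gives \<open>g k\<close> a term of
    \<open>z * hsum 1 z\<close>. The recurrence of the coefficients gives \<open>g (k + 1)\<close> a
    term of \<open>(z + 1/2) * hsum 1 (z + 1)\<close>, with the same leading
    \<open>half_coeff k\<close>.\<close>
  define g where "g k = real k * half_coeff k / (real k + z)" for k
  have g_eq: "g k = half_coeff k - z * (half_coeff k / (real k + z))" for k
    using assms[of k] by (simp add: g_def field_simps)
  have "(\<lambda>k. z * (half_coeff k / (real k + z))) \<longlonglongrightarrow> z * 0"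
    using hsum_1_sums[of z] by (intro tendsto_intros summable_LIMSEQ_zero) (simp add: sums_iff)
  hence "g \<longlonglongrightarrow> 0 - z * 0"
    unfolding g_eq by (intro tendsto_diff half_coeff_tendsto_0)
  hence "(\<lambda>k. g k - g (Suc k)) sums (g 0 - 0)"
    by (intro telescope_sums') simp
  moreover have "g k - g (Suc k) =
      (z + 1/2) * (half_coeff k / (real k + (z + 1))) - z * (half_coeff k / (real k + z))" for k
  proof -
    have nz: "real k + (z + 1) \<noteq> 0" "real k + z \<noteq> 0"
      using assms[of k] assms[of "Suc k"] by (simp_all add: algebra_simps)
    have "g (Suc k) = (real k + 1/2) * half_coeff k / (real k + (z + 1))"
      using Suc_times_half_coeff_Suc[of k] by (simp add: g_def algebra_simps)
    also have "\<dots> = half_coeff k - (z + 1/2) * (half_coeff k / (real k + (z + 1)))"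
      using nz by (simp add: field_simps)
    finally show ?thesis
      unfolding g_eq[of k] by simp
  qed
  moreover have "(\<lambda>k. (z + 1/2) * (half_coeff k / (real k + (z + 1))) - z * (half_coeff k / (real k + z)))
      sums ((z + 1/2) * hsum 1 (z + 1) - z * hsum 1 z)"
    by (intro sums_diff sums_mult hsum_1_sums)
  ultimately show ?thesis
    by (auto simp: g_def dest: sums_unique2)
qed

text \<open>Since \<open>x / 0 = 0\<close>, this holds for every real \<open>z\<close>.  It is used at \<open>z = 0\<close>, where
  \<open>hsum n 0\<close> is the sum over positive indices.\<close>
lemma hsum_rec:
  assumes "n \<ge> 1"
  shows "(z + 1/2) * hsum (Suc n) (z + 1) - hsum n (z + 1) = z * hsum (Suc n) z - hsum n z"
proof -
  \<comment> \<open>This is the k-th term of the right side. It vanishes at \<open>k = 0\<close>, so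
    the sum may start at 1, and there the recurrence of the coefficients identifies it with the left
    side.\<close>
  define g where "g k = - (real k * half_coeff k / (real k + z) ^ Suc n)" for k
  have *: "x * (c / (k + x) ^ Suc n) - c / (k + x) ^ n = - (k * c / (k + x) ^ Suc n)"
    if "n \<ge> 1" for x c k :: real
  proof (cases "k + x = 0")
    case False
    have "c / (k + x) ^ n = (k + x) * (c / (k + x) ^ Suc n)"
      using False by simp
    also have "\<dots> = k * c / (k + x) ^ Suc n + x * (c / (k + x) ^ Suc n)"
      by (simp only: distrib_right times_divide_eq_right add_divide_distrib)
    finally show ?thesis
      by linarith
  qed (use that in \<open>auto simp: power_0_left\<close>)
  have g_eq: "z * (half_coeff k / (real k + z) ^ Suc n) - half_coeff k / (real k + z) ^ n = g k" for k
    using *[OF assms] unfolding g_def .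
  have "(\<lambda>k. z * (half_coeff k / (real k + z) ^ Suc n) - half_coeff k / (real k + z) ^ n)
      sums (z * hsum (Suc n) z - hsum n z)"
    by (intro sums_diff sums_mult hsum_sums assms) simp
  hence "g sums (z * hsum (Suc n) z - hsum n z)"
    unfolding g_eq .
  moreover have "g 0 = 0"
    by (simp add: g_def)
  ultimately have 1: "(\<lambda>k. g (Suc k)) sums (z * hsum (Suc n) z - hsum n z)"
    by (simp add: sums_Suc_iff)
  have gS: "(z + 1/2) * (half_coeff k / (real k + (z + 1)) ^ Suc n)
      - half_coeff k / (real k + (z + 1)) ^ n = g (Suc k)" for k
  proof -
    have "g (Suc k) = - ((real k + 1/2) * half_coeff k / ((real k + 1/2) + (z + 1/2)) ^ Suc n)"
      unfolding g_def Suc_times_half_coeff_Suc[symmetric] by (simp add: algebra_simps)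
    also have "\<dots> = (z + 1/2) * (half_coeff k / ((real k + 1/2) + (z + 1/2)) ^ Suc n)
      - half_coeff k / ((real k + 1/2) + (z + 1/2)) ^ n"
      by (rule *[OF assms, symmetric])
    finally show ?thesis
      by (simp add: algebra_simps)
  qed
  have "(\<lambda>k. (z + 1/2) * (half_coeff k / (real k + (z + 1)) ^ Suc n)
      - half_coeff k / (real k + (z + 1)) ^ n) sums ((z + 1/2) * hsum (Suc n) (z + 1) - hsum n (z + 1))"
    by (intro sums_diff sums_mult hsum_sums assms) simp
  hence "(\<lambda>k. g (Suc k)) sums ((z + 1/2) * hsum (Suc n) (z + 1) - hsum n (z + 1))"
    unfolding gS .
  from sums_unique2[OF this 1] show ?thesis .
qed

section \<open>Closed forms at integers and half-integers\<close>

lemma hsum_1_nat: "hsum 1 (real (Suc a)) = 1 / (real (Suc a) * half_coeff (Suc a))"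
proof (induction a)
  case 0
  show ?case
    using hsum_1_sums[of 1] half_coeff_over_Suc_sums
    by (auto simp: half_coeff_Suc dest: sums_unique2)
next
  case (Suc a)
  have "(real (Suc a) + 1/2) * hsum 1 (real (Suc a) + 1) = real (Suc a) * hsum 1 (real (Suc a))"
    by (rule hsum_1_rec) (metis of_nat_0_le_iff of_nat_0_less_iff zero_less_Suc add_nonneg_pos less_irrefl)
  also have "\<dots> = 1 / half_coeff (Suc a)"
    unfolding Suc by simp
  finally have "hsum 1 (real (Suc a) + 1) = 1 / half_coeff (Suc a) / (real (Suc a) + 1/2)"
    by (subst eq_divide_eq) (auto simp: mult.commute)
  also have "\<dots> = 1 / ((real (Suc a) + 1) * half_coeff (Suc (Suc a)))"
    unfolding Suc_times_half_coeff_Suc by (simp add: mult.commute)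
  finally show ?case
    by (simp add: algebra_simps)
qed

lemma hsum_1_half_rec: "hsum 1 (real b + 1/2) = hsum 1 (1/2) * half_coeff b"
proof (induction b)
  case (Suc b)
  have "(real b + 1/2 + 1/2) * hsum 1 (real b + 1/2 + 1) = (real b + 1/2) * hsum 1 (real b + 1/2)"
    by (rule hsum_1_rec) (simp add: add_nonneg_eq_0_iff)
  then have "(real b + 1) * hsum 1 (real (Suc b) + 1/2) = (real b + 1/2) * hsum 1 (real b + 1/2)"
    by (simp add: algebra_simps)
  also have "\<dots> = (real b + 1) * (hsum 1 (1/2) * half_coeff (Suc b))"
    unfolding Suc using Suc_times_half_coeff_Suc[of b] by (metis mult.left_commute)
  finally show ?case
    by (subst (asm) mult_cancel_left) auto
qed simp

text \<open>By monotonicity, the value at \<open>n + 3/2\<close> lies between those at the integers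
  \<open>n + 1\<close> and \<open>n + 2\<close>. Dividing by \<open>half_coeff (n + 1)\<close>
  squeezes \<open>hsum 1 (1/2)\<close> between two sequences that tend to \<open>pi\<close> by
  Wallis.\<close>

lemma hsum_1_one_half: "hsum 1 (1/2) = pi"
proof (rule antisym)
  have wallis': "(\<lambda>n. real (Suc n) * (half_coeff (Suc n))\<^sup>2) \<longlonglongrightarrow> 1 / pi"
    using half_coeff_wallis by (rule LIMSEQ_Suc)
  have half_sq: "(\<lambda>n. (half_coeff (Suc n))\<^sup>2 / 2) \<longlonglongrightarrow> 0\<^sup>2 / 2"
    by (intro tendsto_intros LIMSEQ_Suc[OF half_coeff_tendsto_0]) auto
  have up: "hsum 1 (1/2) \<le> 1 / (real (Suc n) * (half_coeff (Suc n))\<^sup>2)" for n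
  proof -
    have "hsum 1 (1/2) * half_coeff (Suc n) \<le> hsum 1 (real (Suc n))"
      unfolding hsum_1_half_rec[symmetric] by (rule hsum_antimono) auto
    then have "hsum 1 (1/2) \<le> 1 / (real (Suc n) * half_coeff (Suc n)) / half_coeff (Suc n)"
      unfolding hsum_1_nat by (subst pos_le_divide_eq) auto
    then show ?thesis
      by (simp add: power2_eq_square mult.assoc)
  qed
  have "(\<lambda>n. 1 / (real (Suc n) * (half_coeff (Suc n))\<^sup>2)) \<longlonglongrightarrow> 1 / (1 / pi)"
    by (intro tendsto_intros wallis') simp
  then show "hsum 1 (1/2) \<le> pi"
    using up by (intro LIMSEQ_le_const[where X = "\<lambda>n. 1 / (real (Suc n) * (half_coeff (Suc n))\<^sup>2)"]) auto
  have low: "hsum 1 (1/2) \<ge> 1 / (real (Suc n) * (half_coeff (Suc n))\<^sup>2 + (half_coeff (Suc n))\<^sup>2 / 2)" for n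
  proof -
    have "hsum 1 (real (Suc (Suc n))) \<le> hsum 1 (1/2) * half_coeff (Suc n)"
      unfolding hsum_1_half_rec[symmetric] by (rule hsum_antimono) auto
    moreover have "hsum 1 (real (Suc (Suc n))) = 1 / ((real (Suc n) + 1/2) * half_coeff (Suc n))"
      unfolding hsum_1_nat Suc_times_half_coeff_Suc[symmetric] by (simp add: algebra_simps)
    ultimately have "1 / ((real (Suc n) + 1/2) * half_coeff (Suc n)) / half_coeff (Suc n)
        \<le> hsum 1 (1/2)"
      by (subst pos_divide_le_eq) auto
    moreover have "1 / ((real (Suc n) + 1/2) * half_coeff (Suc n)) / half_coeff (Suc n) =
        1 / (real (Suc n) * (half_coeff (Suc n))\<^sup>2 + (half_coeff (Suc n))\<^sup>2 / 2)"
      by (simp add: power2_eq_square algebra_simps)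
    ultimately show ?thesis by simp
  qed
  have "(\<lambda>n. 1 / (real (Suc n) * (half_coeff (Suc n))\<^sup>2 + (half_coeff (Suc n))\<^sup>2 / 2))
      \<longlonglongrightarrow> 1 / (1 / pi + 0\<^sup>2 / 2)"
    by (intro tendsto_divide tendsto_const tendsto_add wallis' half_sq) simp
  then show "pi \<le> hsum 1 (1/2)"
    using low by (intro LIMSEQ_le_const2[where X = "\<lambda>n. 1 / (real (Suc n) * (half_coeff (Suc n))\<^sup>2 + (half_coeff (Suc n))\<^sup>2 / 2)"]) auto
qed

lemma hsum_1_half: "hsum 1 (real b + 1/2) = pi * half_coeff b"
  unfolding hsum_1_half_rec hsum_1_one_half ..

lemma half_int_neq_0: "real k + (1/2 - real a) \<noteq> 0"
proof
  assume "real k + (1/2 - real a) = 0"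
  hence "real (2 * k + 1) = real (2 * a)" by simp
  hence "2 * k + 1 = 2 * a" by (simp only: of_nat_eq_iff)
  thus False by presburger
qed

text \<open>At \<open>z = -1/2\<close> the factor \<open>z + 1/2\<close> of the recurrence vanishes;
  the zero then propagates downwards in steps of 1.\<close>

lemma hsum_1_neg_half: "hsum 1 (1/2 - real (Suc a)) = 0"
proof (induction a)
  case 0
  show ?case
    using hsum_1_rec[OF half_int_neq_0, of 1] by simp
next
  case (Suc a)
  have eq: "1/2 - real (Suc (Suc a)) + 1 = 1/2 - real (Suc a)" by simp
  have "(1/2 - real (Suc (Suc a))) * hsum 1 (1/2 - real (Suc (Suc a))) = 0"
    using hsum_1_rec[OF half_int_neq_0, of "Suc (Suc a)"] unfolding eq Suc by simp
  then show ?case by simp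
qed

text \<open>Where \<open>hsum 1\<close> vanishes, \<open>hsum_rec\<close> becomes a two-term
  recurrence for \<open>hsum 2\<close>. The factor \<open>pi\<close> enters at
  \<open>z = -1/2\<close> through \<open>hsum 1 (1/2)\<close>. This sums the denominators
  \<open>(b - a + 1/2)^2\<close>.\<close>

lemma hsum_2_neg_half:
  "hsum 2 (1/2 - real (Suc a)) = pi / (real (Suc a) * half_coeff (Suc a))"
proof (induction a)
  case 0
  have "- hsum 1 (1/2) = (-1/2) * hsum 2 (-1/2) - hsum 1 (-1/2)"
    using hsum_rec[of 1 "-1/2"] by (simp add: numeral_2_eq_2)
  moreover have "hsum 1 (-1/2) = 0"
    using hsum_1_neg_half[of 0] by simp
  ultimately show ?case
    by (simp add: hsum_1_one_half[simplified] half_coeff_Suc)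
next
  case (Suc a)
  have eq: "1/2 - real (Suc (Suc a)) + 1 = 1/2 - real (Suc a)" by simp
  have "(1/2 - real (Suc (Suc a)) + 1/2) * hsum 2 (1/2 - real (Suc a)) =
      (1/2 - real (Suc (Suc a))) * hsum 2 (1/2 - real (Suc (Suc a)))"
    using hsum_rec[of 1 "1/2 - real (Suc (Suc a))"] hsum_1_neg_half[of a] hsum_1_neg_half[of "Suc a"]
    unfolding eq by (simp add: numeral_2_eq_2)
  also have "(1/2 - real (Suc (Suc a)) + 1/2) * hsum 2 (1/2 - real (Suc a)) = - (pi / half_coeff (Suc a))"
  proof -
    have "1/2 - real (Suc (Suc a)) + 1/2 = - real (Suc a)"
      by simp
    then show ?thesis
      unfolding Suc by (simp only: mult_minus_left) simp
  qed
  finally have "(real (Suc a) + 1/2) * hsum 2 (1/2 - real (Suc (Suc a))) = pi / half_coeff (Suc a)"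
    by (simp add: algebra_simps)
  hence "hsum 2 (1/2 - real (Suc (Suc a))) = pi / half_coeff (Suc a) / (real (Suc a) + 1/2)"
    by (subst eq_divide_eq) (auto simp: mult.commute)
  hence "hsum 2 (1/2 - real (Suc (Suc a))) = pi / ((real (Suc a) + 1/2) * half_coeff (Suc a))"
    by (simp add: mult.commute)
  then show ?case
    unfolding Suc_times_half_coeff_Suc[symmetric] by (simp add: add.commute)
qed

subsection \<open>Logarithmic derivatives and zeta values\<close>

definition hratio :: "nat \<Rightarrow> real \<Rightarrow> real" where
  "hratio n z = hsum (Suc n) z / hsum 1 z"

lemma hratio_0:
  assumes "z > 0"
  shows "hratio 0 z = 1"
  using hsum_pos[of 1 z] assms by (simp add: hratio_def)

text \<open>The recurrence \<open>hsum_rec\<close> is divided on both sides by the common value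
  \<open>(z + 1/2) * hsum 1 (z + 1) = z * hsum 1 z\<close>.\<close>

lemma hratio_rec:
  assumes z: "z > 0"
  shows "hratio (Suc n) (z + 1) - hratio n (z + 1) / (z + 1/2) = hratio (Suc n) z - hratio n z / z"
proof -
  have pos: "hsum 1 z > 0" "hsum 1 (z + 1) > 0"
    using z by (auto intro!: hsum_pos)
  have F: "(z + 1/2) * hsum 1 (z + 1) = z * hsum 1 z"
    by (rule hsum_1_rec) (use z in auto)
  have R: "(z + 1/2) * hsum (Suc (Suc n)) (z + 1) - hsum (Suc n) (z + 1) =
      z * hsum (Suc (Suc n)) z - hsum (Suc n) z"
    by (rule hsum_rec) simp
  have "hratio (Suc n) (z + 1) - hratio n (z + 1) / (z + 1/2) =
      ((z + 1/2) * hsum (Suc (Suc n)) (z + 1) - hsum (Suc n) (z + 1)) / ((z + 1/2) * hsum 1 (z + 1))"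
    using z pos by (simp add: hratio_def diff_divide_distrib)
  also have "\<dots> = (z * hsum (Suc (Suc n)) z - hsum (Suc n) z) / (z * hsum 1 z)"
    unfolding F R ..
  also have "\<dots> = hratio (Suc n) z - hratio n z / z"
    using z pos by (simp add: hratio_def diff_divide_distrib)
  finally show ?thesis .
qed

lemma hratio_nonneg: "z > 0 \<Longrightarrow> hratio n z \<ge> 0"
  using hsum_pos[of "Suc n" z] hsum_pos[of 1 z] by (simp add: hratio_def)

lemma hratio_le:
  assumes z: "z > 0"
  shows "hratio n z \<le> (1 / z) ^ n"
proof (induction n)
  case (Suc n)
  have "hratio (Suc n) z \<le> hratio n z / z"
    using hsum_Suc_le[of "Suc n" z] hsum_pos[of 1 z] z
    by (simp add: hratio_def field_simps)
  also have "\<dots> \<le> (1 / z) ^ n / z"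
    using Suc z by (intro divide_right_mono) auto
  finally show ?case by (simp add: power_Suc2 del: power_Suc)
qed (use z hratio_0 in auto)

lemma one_over_nat_plus_tendsto_0: "(\<lambda>k. 1 / (real k + z)) \<longlonglongrightarrow> 0"
  using tendsto_inverse_0_at_top[OF filterlim_tendsto_add_at_top[OF tendsto_const[of z] filterlim_real_sequentially]]
  by (simp add: inverse_eq_divide add.commute)

lemma hratio_tendsto_0:
  assumes "z > 0" "n \<ge> 1"
  shows "(\<lambda>k. hratio n (real k + z)) \<longlonglongrightarrow> 0"
proof (rule tendsto_sandwich[where f = "\<lambda>_. 0"])
  from tendsto_power[OF one_over_nat_plus_tendsto_0[of z], of n] show "(\<lambda>k. (1 / (real k + z)) ^ n) \<longlonglongrightarrow> 0"
    using assms(2) by (simp add: power_0_left)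
qed (use assms in \<open>auto intro!: always_eventually hratio_nonneg hratio_le add_nonneg_pos\<close>)

text \<open>Up to sign, \<open>hratio 1\<close> is the logarithmic derivative of \<open>hsum 1\<close>.  The combinations of the
  \<open>hratio n\<close> below are its derivatives up to constant factors, which is why they telescope.\<close>

lemma hratio_telescope:
  assumes z: "z > 0" and lim: "(\<lambda>k. f (real k + z)) \<longlonglongrightarrow> 0"
    and step: "\<And>w. w > 0 \<Longrightarrow> f w - f (w + 1) = (1 / w) ^ j - (1 / (w + 1/2)) ^ j"
  shows "(\<lambda>k. (1 / (real k + z)) ^ j - (1 / (real k + z + 1/2)) ^ j) sums (f z :: real)"
proof -
  have "(\<lambda>k. f (real k + z) - f (real (Suc k) + z)) sums (f (real 0 + z) - 0)"
    by (rule telescope_sums'[OF lim])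
  moreover have "f (real k + z) - f (real (Suc k) + z) = (1 / (real k + z)) ^ j - (1 / (real k + z + 1/2)) ^ j" for k
    using step[of "real k + z"] z by (simp add: algebra_simps)
  ultimately show ?thesis by simp
qed

lemma hratio_1_step:
  assumes "w > 0"
  shows "hratio 1 (w + 1) = hratio 1 w + (1 / (w + 1/2) - 1 / w)"
  using hratio_rec[OF assms, of 0] hratio_0[of w] hratio_0[of "w + 1"] assms by simp

lemma hratio_2_step:
  assumes "w > 0"
  shows "hratio 2 (w + 1) = hratio 2 w + hratio 1 (w + 1) * (1 / (w + 1/2)) - hratio 1 w * (1 / w)"
  using hratio_rec[OF assms, of 1] by (simp add: numeral_2_eq_2)

lemma hratio_3_step:
  assumes "w > 0"
  shows "hratio 3 (w + 1) = hratio 3 w + hratio 2 (w + 1) * (1 / (w + 1/2)) - hratio 2 w * (1 / w)"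
  using hratio_rec[OF assms, of 2] by (simp add: numeral_2_eq_2 numeral_3_eq_3)

lemma hratio_1_sums:
  assumes "z > 0"
  shows "(\<lambda>k. 1 / (real k + z) - 1 / (real k + z + 1/2)) sums hratio 1 z"
  using hratio_telescope[OF assms hratio_tendsto_0[OF assms order_refl], of 1] hratio_1_step
  by simp

text \<open>With F = \<open>hsum 1\<close>, the limit is (log F)''(z).\<close>

lemma hratio_2_sums:
  assumes "z > 0"
  shows "(\<lambda>k. (1 / (real k + z))\<^sup>2 - (1 / (real k + z + 1/2))\<^sup>2) sums
           (2 * hratio 2 z - (hratio 1 z)\<^sup>2)"
proof (rule hratio_telescope[OF assms, where f = "\<lambda>z. 2 * hratio 2 z - (hratio 1 z)\<^sup>2"])
  have "(\<lambda>k. 2 * hratio 2 (real k + z) - (hratio 1 (real k + z))\<^sup>2) \<longlonglongrightarrow> 2 * 0 - 0\<^sup>2"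
    by (intro tendsto_intros hratio_tendsto_0 assms) auto
  then show "(\<lambda>k. 2 * hratio 2 (real k + z) - (hratio 1 (real k + z))\<^sup>2) \<longlonglongrightarrow> 0"
    by simp
next
  fix w :: real assume w: "w > 0"
  define a b where "a = 1 / (w + 1/2)" and "b = 1 / w"
  show "2 * hratio 2 w - (hratio 1 w)\<^sup>2 - (2 * hratio 2 (w + 1) - (hratio 1 (w + 1))\<^sup>2)
      = (1 / w)\<^sup>2 - (1 / (w + 1/2))\<^sup>2"
    unfolding hratio_2_step[OF w] hratio_1_step[OF w] a_def[symmetric] b_def[symmetric]
    by algebra
qed

text \<open>With F = \<open>hsum 1\<close>, the limit is -(log F)'''(z) / 2.\<close>

lemma hratio_3_sums:
  assumes "z > 0"
  shows "(\<lambda>k. (1 / (real k + z)) ^ 3 - (1 / (real k + z + 1/2)) ^ 3) sums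
           (3 * hratio 3 z - 3 * hratio 1 z * hratio 2 z + (hratio 1 z) ^ 3)"
proof (rule hratio_telescope[OF assms,
      where f = "\<lambda>z. 3 * hratio 3 z - 3 * hratio 1 z * hratio 2 z + (hratio 1 z) ^ 3"])
  have "(\<lambda>k. 3 * hratio 3 (real k + z) - 3 * hratio 1 (real k + z) * hratio 2 (real k + z)
      + (hratio 1 (real k + z)) ^ 3) \<longlonglongrightarrow> 3 * 0 - 3 * 0 * 0 + 0 ^ 3"
    by (intro tendsto_intros hratio_tendsto_0 assms) auto
  then show "(\<lambda>k. 3 * hratio 3 (real k + z) - 3 * hratio 1 (real k + z) * hratio 2 (real k + z)
      + (hratio 1 (real k + z)) ^ 3) \<longlonglongrightarrow> 0"
    by simp
next
  fix w :: real assume w: "w > 0"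
  define a b where "a = 1 / (w + 1/2)" and "b = 1 / w"
  show "3 * hratio 3 w - 3 * hratio 1 w * hratio 2 w + (hratio 1 w) ^ 3
      - (3 * hratio 3 (w + 1) - 3 * hratio 1 (w + 1) * hratio 2 (w + 1) + (hratio 1 (w + 1)) ^ 3)
      = (1 / w) ^ 3 - (1 / (w + 1/2)) ^ 3"
    unfolding hratio_3_step[OF w] hratio_2_step[OF w] hratio_1_step[OF w] a_def[symmetric] b_def[symmetric]
    by algebra
qed

section \<open>Evaluation by logarithms and zeta values\<close>

lemma zeta_nat_sums:
  assumes "n \<ge> 2"
  shows "(\<lambda>k. 1 / (real k + 1) ^ n) sums zeta (real n)"
proof -
  have "1 / real (Suc k) powr real n = 1 / (real k + 1) ^ n" for k
    by (subst powr_realpow) (auto simp: add.commute)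
  moreover have "summable (\<lambda>k. 1 / (real k + 1) ^ n)"
    using inverse_power_summable[OF assms, where 'a = real]
    by (subst (asm) summable_Suc_iff[symmetric]) (simp add: inverse_eq_divide add.commute)
  ultimately show ?thesis
    unfolding zeta_def by (simp add: summable_sums)
qed

text \<open>The zeta series times \<open>2 ^ n\<close>, grouped in pairs, has its odd denominators
  in the terms \<open>1 / (k + 1/2) ^ n\<close> and its even ones in a second copy of the zeta
  series, which is subtracted.\<close>

lemma half_odd_power_sums:
  assumes "n \<ge> 2"
  shows "(\<lambda>k. 1 / (real k + 1/2) ^ n) sums ((2 ^ n - 1) * zeta (real n))"
proof -
  have "(\<lambda>k. 2 ^ n * (1 / (real k + 1) ^ n)) sums (2 ^ n * zeta (real n))"
    by (intro sums_mult zeta_nat_sums assms)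
  moreover have "(\<lambda>k. \<Sum>i = k * 2..<k * 2 + 2. 2 ^ n * (1 / (real i + 1) ^ n)) sums (2 ^ n * zeta (real n))"
    by (rule sums_group) (use calculation in auto)
  moreover have "(\<Sum>i = k * 2..<k * 2 + 2. 2 ^ n * (1 / (real i + 1) ^ n)) =
      1 / (real k + 1/2) ^ n + 1 / (real k + 1) ^ n" for k
  proof -
    have "{k * 2..<k * 2 + 2} = {k * 2, k * 2 + 1}" by auto
    moreover have "2 ^ n * (1 / (2 * x) ^ n) = 1 / x ^ n" for x :: real
      by (simp add: power_mult_distrib)
    from this[of "real k + 1/2"] this[of "real k + 1"]
    have "2 ^ n * (1 / (real (k * 2) + 1) ^ n) = 1 / (real k + 1/2) ^ n"
      "2 ^ n * (1 / (real (k * 2 + 1) + 1) ^ n) = 1 / (real k + 1) ^ n"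
      by (simp_all add: algebra_simps)
    ultimately show ?thesis by simp
  qed
  ultimately have "(\<lambda>k. 1 / (real k + 1/2) ^ n + 1 / (real k + 1) ^ n) sums (2 ^ n * zeta (real n))"
    by simp
  from sums_diff[OF this zeta_nat_sums[OF assms]] show ?thesis
    by (simp add: algebra_simps)
qed

text \<open>This is twice the alternating harmonic series, grouped in pairs.\<close>

lemma half_odd_minus_int_sums: "(\<lambda>k. 1 / (real k + 1/2) - 1 / (real k + 1)) sums gamma1"
proof -
  have group: "(\<lambda>k. \<Sum>i = k * 2..<k * 2 + 2. (-1) ^ i / real (Suc i)) sums ln 2"
    by (rule sums_group[OF alternating_harmonic_series_sums]) simp
  have eq: "(\<Sum>i = k * 2..<k * 2 + 2. (-1) ^ i / real (Suc i)) =
     1/2 * (1 / (real k + 1/2) - 1 / (real k + 1))" for k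
  proof -
    have "{k * 2..<k * 2 + 2} = {k * 2, k * 2 + 1}" by auto
    then show ?thesis by (simp add: divide_simps) (simp add: algebra_simps)
  qed
  have "2 * (1/2 * x) = x" for x :: real
    by simp
  from sums_mult[OF group[unfolded eq], of 2, unfolded this]
  have "(\<lambda>k. 1 / (real k + 1/2) - 1 / (real k + 1)) sums (2 * ln 2)" .
  moreover have "gamma1 = 2 * ln 2"
    using ln_realpow[of 2 2] by (simp add: gamma1_def)
  ultimately show ?thesis by simp
qed

text \<open>At \<open>z = 1/2\<close> the telescoped series are half-odd powers minus integer
  powers, with sums \<open>gamma1\<close>, \<open>2 * zeta 2\<close> and \<open>6 * zeta 3\<close>;
  these are solved for the ratios one after another.\<close>

lemma hratio_one_half:
  "hratio 1 (1/2) = gamma1"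
  "hratio 2 (1/2) = zeta 2 + gamma1\<^sup>2 / 2"
  "hratio 3 (1/2) = 2 * zeta 3 + gamma1 * zeta 2 + gamma1 ^ 3 / 6"
proof -
  show 1: "hratio 1 (1/2) = gamma1"
    using hratio_1_sums[of "1/2"] half_odd_minus_int_sums
    by (auto simp: add.commute[of 1] dest: sums_unique2)
  have "(\<lambda>k. 1 / (real k + 1/2) ^ 2 - 1 / (real k + 1) ^ 2) sums (3 * zeta 2 - zeta 2)"
    using sums_diff[OF half_odd_power_sums[of 2] zeta_nat_sums[of 2]] by simp
  with hratio_2_sums[of "1/2"] have "2 * hratio 2 (1/2) - (hratio 1 (1/2))\<^sup>2 = 3 * zeta 2 - zeta 2"
    by (intro sums_unique2) (auto simp: power_divide add.commute[of 1])
  then show 2: "hratio 2 (1/2) = zeta 2 + gamma1\<^sup>2 / 2"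
    unfolding 1 by simp
  have "(\<lambda>k. 1 / (real k + 1/2) ^ 3 - 1 / (real k + 1) ^ 3) sums (7 * zeta 3 - zeta 3)"
    using sums_diff[OF half_odd_power_sums[of 3] zeta_nat_sums[of 3]] by simp
  with hratio_3_sums[of "1/2"]
  have "3 * hratio 3 (1/2) - 3 * hratio 1 (1/2) * hratio 2 (1/2) + (hratio 1 (1/2)) ^ 3 = 7 * zeta 3 - zeta 3"
    by (intro sums_unique2) (auto simp: power_divide add.commute[of 1])
  then show "hratio 3 (1/2) = 2 * zeta 3 + gamma1 * zeta 2 + gamma1 ^ 3 / 6"
    unfolding 1 2 by (simp add: algebra_simps power2_eq_square power3_eq_cube)
qed

text \<open>At \<open>z = 1\<close> the half-odd series begins at 3/2; its missing first term
  accounts for the constants 2 and 4.\<close>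

lemma hratio_one:
  "hratio 1 1 = 2 - gamma1"
  "hratio 2 1 = 2 - zeta 2 + (2 - gamma1)\<^sup>2 / 2"
proof -
  have eq: "real k + 1 + 1/2 = real (Suc k) + 1/2" for k by simp
  have "(\<lambda>k. 1 / (real k + 1) - 1 / (real k + 1 + 1/2)) sums (2 - gamma1)"
  proof -
    have "(\<lambda>k. 1 / (real k + 1/2) - 1 / (real (Suc k) + 1/2)) sums (1 / (real 0 + 1/2) - 0)"
      by (intro telescope_sums' one_over_nat_plus_tendsto_0)
    from sums_diff[OF this half_odd_minus_int_sums] show ?thesis
      by (simp add: eq add.commute)
  qed
  with hratio_1_sums[of 1] show 1: "hratio 1 1 = 2 - gamma1"
    by (auto dest: sums_unique2)
  have "(\<lambda>k. 1 / (real (Suc k) + 1/2) ^ 2) sums (3 * zeta 2 - 4)"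
    using half_odd_power_sums[of 2] by (subst sums_Suc_iff) (simp add: power2_eq_square)
  from sums_diff[OF zeta_nat_sums[of 2] this]
  have "(\<lambda>k. 1 / (real k + 1) ^ 2 - 1 / (real (Suc k) + 1/2) ^ 2) sums (zeta 2 - (3 * zeta 2 - 4))"
    by simp
  with hratio_2_sums[of 1] have "2 * hratio 2 1 - (hratio 1 1)\<^sup>2 = zeta 2 - (3 * zeta 2 - 4)"
    unfolding eq by (intro sums_unique2) (auto simp: power_divide add.commute[of 1])
  then show "hratio 2 1 = 2 - zeta 2 + (2 - gamma1)\<^sup>2 / 2"
    unfolding 1 by simp
qed

lemma hsum_one_half:
  "hsum 2 (1/2) = pi * gamma1"
  "hsum 3 (1/2) = pi * (zeta 2 + gamma1\<^sup>2 / 2)"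
  "hsum 4 (1/2) = pi * (2 * zeta 3 + gamma1 * zeta 2 + gamma1 ^ 3 / 6)"
proof -
  have *: "hsum (Suc n) (1/2) = pi * hratio n (1/2)" for n
    unfolding hratio_def hsum_1_one_half by simp
  show "hsum 2 (1/2) = pi * gamma1"
    using *[of 1] unfolding hratio_one_half by (simp add: numeral_2_eq_2)
  show "hsum 3 (1/2) = pi * (zeta 2 + gamma1\<^sup>2 / 2)"
    using *[of 2] unfolding hratio_one_half by simp
  show "hsum 4 (1/2) = pi * (2 * zeta 3 + gamma1 * zeta 2 + gamma1 ^ 3 / 6)"
    using *[of 3] unfolding hratio_one_half by simp
qed

text \<open>At \<open>z = 0\<close> the term \<open>z * hsum (Suc n) z\<close> drops out of
  \<open>hsum_rec\<close>, which expresses \<open>hsum n 0\<close> by values at 1.\<close>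

lemma hsum_0:
  "hsum 1 0 = gamma1"
  "hsum 2 0 = zeta 2 - gamma1\<^sup>2 / 2"
proof -
  have F1: "hsum 1 1 = 2"
    using hsum_1_nat[of 0] by (simp add: half_coeff_Suc)
  have *: "hsum (Suc n) 1 = 2 * hratio n 1" for n
    unfolding hratio_def F1 by simp
  have F2: "hsum 2 1 = 2 * (2 - gamma1)"
    using *[of 1] unfolding hratio_one by (simp add: numeral_2_eq_2)
  have F3: "hsum 3 1 = 2 * (2 - zeta 2 + (2 - gamma1)\<^sup>2 / 2)"
    using *[of 2] unfolding hratio_one by simp
  have "hsum 1 0 = hsum 1 1 - hsum 2 1 / 2"
    using hsum_rec[of 1 0] by (simp add: numeral_2_eq_2)
  then show "hsum 1 0 = gamma1"
    unfolding F1 F2 by (simp add: field_simps)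
  have "hsum 2 0 = hsum 2 1 - hsum 3 1 / 2"
    using hsum_rec[of 2 0] by simp
  then show "hsum 2 0 = zeta 2 - gamma1\<^sup>2 / 2"
    unfolding F2 F3 by (simp add: field_simps power2_eq_square)
qed

subsection \<open>The Wilf--Zeilberger evaluation\<close>

text \<open>Where the Gamma function is defined this is \<Gamma>(x+1)^2 / (\<Gamma>(x+1-N)
  \<Gamma>(x+1+N)).\<close>

definition wz_factor :: "nat \<Rightarrow> real \<Rightarrow> real" where
  "wz_factor N x = (\<Prod>j<N. (x - real j) / (x + 1 + real j))"

lemma wz_factor_0 [simp]: "wz_factor 0 x = 1"
  by (simp add: wz_factor_def)

lemma wz_factor_Suc: "wz_factor (Suc N) x = wz_factor N x * ((x - real N) / (x + 1 + real N))"
  by (simp add: wz_factor_def)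

text \<open>The induction step rests on \<open>(x + N) * (x + N + 2) \<le> (x + N + 1)^2\<close>.
  The bound gives both domination by 1 and decay in \<open>N\<close>.\<close>

lemma wz_factor_bound:
  assumes "x \<ge> 0"
  shows "\<bar>wz_factor N x\<bar> \<le> (x + 1) / (x + 1 + real N)"
proof (induction N)
  case (Suc N)
  have "\<bar>x - real N\<bar> \<le> x + real N"
    using assms by linarith
  hence "\<bar>x - real N\<bar> * (x + real N + 2) \<le> (x + real N) * (x + real N + 2)"
    using assms by (intro mult_right_mono) auto
  also have "\<dots> \<le> (x + 1 + real N) * (x + 1 + real N)"
    by (simp add: algebra_simps)
  finally have "\<bar>x - real N\<bar> / (x + 1 + real N) \<le> (x + 1 + real N) / (x + real N + 2)"
    using assms by (simp add: pos_divide_le_eq pos_le_divide_eq)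
  hence "\<bar>wz_factor N x\<bar> * (\<bar>x - real N\<bar> / (x + 1 + real N)) \<le>
      (x + 1) / (x + 1 + real N) * ((x + 1 + real N) / (x + real N + 2))"
    using assms by (intro mult_mono Suc) auto
  then show ?case
    using assms by (simp add: wz_factor_Suc abs_mult abs_divide add_ac)
qed (use assms in auto)

text \<open>The quotient of the factors at \<open>x + 1\<close> and \<open>x\<close> is kept
  multiplied out because \<open>x + 1 - N\<close> may be 0.\<close>

lemma wz_factor_shift:
  assumes "x \<ge> 0"
  shows "wz_factor N (x + 1) * (x + 1 - real N) * (x + 1 + real N) = wz_factor N x * (x + 1)\<^sup>2"
proof (induction N)
  case (Suc N)
  have nz: "x + 1 + real N \<noteq> 0" "x + 2 + real N \<noteq> 0"
    using assms by auto
  have "wz_factor (Suc N) (x + 1) * (x + 1 - real (Suc N)) * (x + 1 + real (Suc N)) =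
      wz_factor N (x + 1) * (x + 1 - real N) * (x - real N)"
    using nz by (simp add: wz_factor_Suc field_simps)
  also have "\<dots> = wz_factor N (x + 1) * (x + 1 - real N) * (x + 1 + real N) * ((x - real N) / (x + 1 + real N))"
    using nz by simp
  also have "\<dots> = wz_factor (Suc N) x * (x + 1)\<^sup>2"
    unfolding Suc wz_factor_Suc by (simp only: mult_ac)
  finally show ?case .
qed (simp add: power2_eq_square)

lemma wz_factor_tendsto_1: "(\<lambda>m. wz_factor N (x + real m)) \<longlonglongrightarrow> 1"
proof (induction N)
  case (Suc N)
  have "(\<lambda>m. 1 - (2 * real N + 1) * (1 / (real m + (x + 1 + real N)))) \<longlonglongrightarrow> 1 - (2 * real N + 1) * 0"
    by (intro tendsto_intros one_over_nat_plus_tendsto_0)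
  moreover have "\<forall>\<^sub>F m in sequentially. 1 - (2 * real N + 1) * (1 / (real m + (x + 1 + real N))) =
      (x + real m - real N) / (x + real m + 1 + real N)"
  proof -
    have "\<forall>\<^sub>F m in sequentially. real m \<ge> \<bar>x\<bar>"
      using filterlim_real_sequentially by (simp add: filterlim_at_top)
    then show ?thesis
    proof eventually_elim
      case (elim m)
      have "real m + x \<ge> 0"
        using elim abs_ge_minus_self[of x] by linarith
      hence "x + real m + 1 + real N \<noteq> 0"
        by (simp add: add_ac add_nonneg_eq_0_iff)
      then show ?case
        by (simp add: field_simps)
    qed
  qed
  ultimately have "(\<lambda>m. (x + real m - real N) / (x + real m + 1 + real N)) \<longlonglongrightarrow> 1"
    by (simp add: tendsto_cong)
  from tendsto_mult[OF Suc this] show ?case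
    by (simp add: wz_factor_Suc)
qed simp

lemma wz_factor_tendsto_0:
  assumes "x \<ge> 0"
  shows "(\<lambda>N. wz_factor N x) \<longlonglongrightarrow> 0"
proof (rule tendsto_rabs_zero_cancel, rule tendsto_sandwich[where f = "\<lambda>_. 0"])
  have "(\<lambda>N. (x + 1) * (1 / (real N + (x + 1)))) \<longlonglongrightarrow> (x + 1) * 0"
    by (intro tendsto_intros one_over_nat_plus_tendsto_0)
  then show "(\<lambda>N. (x + 1) / (x + 1 + real N)) \<longlonglongrightarrow> 0"
    by (simp add: add_ac)
qed (use wz_factor_bound[OF assms] in auto)

text \<open>Successive values of the left side have ratio \<open>- (N + 1/2) / (N + 3/2)\<close>.
  The sign cancels the alternation in the final telescoping over \<open>N\<close>.\<close>

lemma wz_factor_one_half: "wz_factor N (1/2) * (1/2 - real N) = (- 1) ^ N / (4 * (real N + 1/2))"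
proof (induction N)
  case (Suc N)
  have "wz_factor (Suc N) (1/2) * (1/2 - real (Suc N)) =
     (wz_factor N (1/2) * (1/2 - real N)) * ((1/2 - real (Suc N)) / (1/2 + 1 + real N))"
    by (simp add: wz_factor_Suc)
  also have "\<dots> = (- 1) ^ N / (4 * (real N + 1/2)) * (- (real N + 1/2) / (1/2 + 1 + real N))"
    unfolding Suc by simp
  also have "\<dots> = (- 1) ^ Suc N / (4 * (real (Suc N) + 1/2))"
    by (simp add: divide_simps) (simp add: algebra_simps)
  finally show ?case .
qed simp

text \<open>Row \<open>N\<close> of the Wilf--Zeilberger array: row 0 is the series to be
  evaluated.\<close>

definition wz_sum :: "real \<Rightarrow> (nat \<Rightarrow> real) \<Rightarrow> nat \<Rightarrow> real" where
  "wz_sum x h N = (\<Sum>m. h m / (x + real m + 1/2) * wz_factor N (x + real m))"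

text \<open>The hypothesis \<open>step\<close> holds when \<open>h m\<close> is a constant times
  \<open>(\<Gamma>(y + 1/2) / \<Gamma>(y + 1))\<^sup>2\<close> with \<open>y = x + m\<close>.  Both \<open>half_coeff m\<close> squared (\<open>x = 0\<close>) and
  \<open>1 / ((m + 1) * half_coeff (m + 1))\<close> squared (\<open>x = 1/2\<close>) are of this form, so one
  Wilf--Zeilberger certificate serves both series.\<close>

context
  fixes x M L :: real and h :: "nat \<Rightarrow> real"
  assumes x: "x \<ge> 0"
    and step: "\<And>m. h (Suc m) = h m * ((x + real m + 1/2) / (x + real m + 1))\<^sup>2"
    and h_nonneg: "\<And>m. h m \<ge> 0"
    and h_bound: "\<And>m. h m \<le> M / (real m + 1)"
    and h_lim: "(\<lambda>m. real m * h m) \<longlonglongrightarrow> L"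
begin

text \<open>The majorant is independent of \<open>N\<close>, as dominated convergence over the rows
  requires.\<close>

lemma wz_term_bound:
  "norm (h m / (x + real m + 1/2) * wz_factor N (x + real m)) \<le> 2 * M * (1 / (real m + 1)\<^sup>2)"
proof -
  define y where "y = x + real m"
  have y: "y \<ge> real m" "y \<ge> 0"
    using x by (auto simp: y_def)
  have M: "M \<ge> 0"
    using h_nonneg[of 0] h_bound[of 0] by simp
  have "\<bar>wz_factor N y\<bar> \<le> (y + 1) / (y + 1 + real N)"
    by (rule wz_factor_bound[OF y(2)])
  also have "\<dots> \<le> 1"
    using y by simp
  finally have "\<bar>wz_factor N y\<bar> \<le> 1" .
  moreover have "h m / (y + 1/2) \<le> M / (real m + 1) / ((real m + 1) / 2)"
    using M y by (intro frac_le h_bound divide_nonneg_nonneg) auto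
  ultimately have "h m / (y + 1/2) * \<bar>wz_factor N y\<bar> \<le> M / (real m + 1) / ((real m + 1) / 2) * 1"
    using h_nonneg[of m] M y by (intro mult_mono) auto
  then show ?thesis
    using h_nonneg[of m] y unfolding y_def[symmetric]
    by (simp add: abs_mult power2_eq_square mult_ac)
qed

lemma summable_wz_bound: "summable (\<lambda>m. 2 * M * (1 / (real m + 1)\<^sup>2))"
  using zeta_nat_sums[of 2] by (intro summable_mult) (simp add: sums_iff)

lemma wz_sum_sums: "(\<lambda>m. h m / (x + real m + 1/2) * wz_factor N (x + real m)) sums wz_sum x h N"
  unfolding wz_sum_def
  by (intro summable_sums summable_comparison_test'[OF summable_wz_bound] wz_term_bound)

lemma wz_sum_tendsto_0: "wz_sum x h \<longlonglongrightarrow> 0"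
proof -
  have "((\<lambda>N. \<Sum>m. h m / (x + real m + 1/2) * wz_factor N (x + real m)) \<longlongrightarrow> (\<Sum>m. 0)) sequentially"
  proof (rule tannerys_theorem[THEN conjunct2, THEN conjunct2])
    fix m
    have "(\<lambda>N. h m / (x + real m + 1/2) * wz_factor N (x + real m)) \<longlonglongrightarrow> h m / (x + real m + 1/2) * 0"
      using x by (intro tendsto_intros wz_factor_tendsto_0) auto
    then show "(\<lambda>N. h m / (x + real m + 1/2) * wz_factor N (x + real m)) \<longlonglongrightarrow> 0"
      by simp
  qed (use wz_term_bound summable_wz_bound in \<open>auto intro!: always_eventually\<close>)
  then show ?thesis
    by (simp add: wz_sum_def[abs_def])
qed

text \<open>The terms of two consecutive rows add up to a difference in \<open>m\<close>. Its
  boundary value at infinity yields \<open>L\<close>, and the one at \<open>m = 0\<close> yields the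
  term with \<open>h 0\<close>.\<close>

lemma wz_sum_rec:
  "wz_sum x h N + wz_sum x h (Suc N) =
     2 / (real N + 1/2)\<^sup>2 * (L - h 0 * (x - real N) * wz_factor N x)"
proof -
  define \<kappa> where "\<kappa> = 2 / (real N + 1/2)\<^sup>2"
  \<comment> \<open>This is the certificate. Its difference produces
    \<open>(y + 1/2)^2 - (y - N) * (y + 1 + N) = (N + 1/2)^2\<close> with \<open>y = x + m\<close>,
    which the denominator of \<open>\<kappa>\<close> cancels.\<close>
  define q where "q m = \<kappa> * ((x + real m - real N) * h m * wz_factor N (x + real m))" for m
  have q_step: "q (Suc m) - q m = h m / (x + real m + 1/2) * wz_factor N (x + real m)
      + h m / (x + real m + 1/2) * wz_factor (Suc N) (x + real m)" for m
  proof -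
    define y r where "y = x + real m" and "r = wz_factor N y"
    have y: "y \<ge> 0"
      using x by (simp add: y_def)
    have nz: "y + 1 + real N \<noteq> 0" "y + 1/2 \<noteq> 0" "y + 1 \<noteq> 0"
      using y by auto
    have shift: "wz_factor N (y + 1) * (y + 1 - real N) = r * (y + 1)\<^sup>2 / (y + 1 + real N)"
      using wz_factor_shift[OF y, of N] nz by (simp add: eq_divide_eq r_def)
    have "q (Suc m) = \<kappa> * (wz_factor N (y + 1) * (y + 1 - real N)) * (h m * ((y + 1/2) / (y + 1))\<^sup>2)"
      by (simp add: q_def step y_def algebra_simps)
    also have "\<dots> = \<kappa> * h m * r * (y + 1/2)\<^sup>2 / (y + 1 + real N)"
      unfolding shift using nz by (simp add: power_divide)
    finally have 1: "q (Suc m) = \<kappa> * h m * r * (y + 1/2)\<^sup>2 / (y + 1 + real N)" .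
    have 2: "q m = \<kappa> * h m * r * ((y - real N) * (y + 1 + real N)) / (y + 1 + real N)"
      using nz by (simp add: q_def y_def[symmetric] r_def)
    have "q (Suc m) - q m =
        \<kappa> * h m * r * ((y + 1/2)\<^sup>2 - (y - real N) * (y + 1 + real N)) / (y + 1 + real N)"
      unfolding 1 2 by (simp add: right_diff_distrib diff_divide_distrib)
    also have "(y + 1/2)\<^sup>2 - (y - real N) * (y + 1 + real N) = (real N + 1/2)\<^sup>2"
      by (simp add: power2_eq_square algebra_simps)
    also have "\<kappa> * h m * r * (real N + 1/2)\<^sup>2 / (y + 1 + real N) = 2 * h m * r / (y + 1 + real N)"
      by (simp add: \<kappa>_def add_nonneg_eq_0_iff)
    \<comment> \<open>The last bracket combines row \<open>N\<close> with row \<open>N + 1\<close>,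
      whose factor is \<open>r * (y - N) / (y + 1 + N)\<close>.\<close>
    also have "\<dots> = h m / (y + 1/2) * r * (1 + (y - real N) / (y + 1 + real N))"
    proof -
      have "1 + (y - real N) / (y + 1 + real N) = 2 * (y + 1/2) / (y + 1 + real N)"
        using nz by (simp add: field_simps)
      moreover have "2 * c * r / d = c / k * r * (2 * k / d)" if "k \<noteq> 0" for c d k :: real
        using that by simp
      ultimately show ?thesis
        using nz(2) by (simp only:)
    qed
    also have "\<dots> = h m / (y + 1/2) * r + h m / (y + 1/2) * wz_factor (Suc N) y"
      by (simp add: wz_factor_Suc r_def distrib_left)
    finally show ?thesis
      by (simp add: y_def r_def)
  qed
  have "h \<longlonglongrightarrow> 0"
  proof (rule tendsto_sandwich[where f = "\<lambda>_. 0"])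
    show "(\<lambda>m. M / (real m + 1)) \<longlonglongrightarrow> 0"
      using tendsto_mult_right_zero[OF one_over_nat_plus_tendsto_0[of 1], of M] by simp
  qed (use h_nonneg h_bound in auto)
  hence "(\<lambda>m. \<kappa> * ((real m * h m + (x - real N) * h m) * wz_factor N (x + real m)))
      \<longlonglongrightarrow> \<kappa> * ((L + (x - real N) * 0) * 1)"
    by (intro tendsto_intros h_lim wz_factor_tendsto_1)
  hence "q \<longlonglongrightarrow> \<kappa> * L"
    by (simp add: q_def[abs_def] algebra_simps)
  hence "(\<lambda>m. q (Suc m) - q m) sums (\<kappa> * L - q 0)"
    by (rule telescope_sums)
  moreover have "(\<lambda>m. q (Suc m) - q m) sums (wz_sum x h N + wz_sum x h (Suc N))"
    unfolding q_step by (intro sums_add wz_sum_sums)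
  ultimately have "wz_sum x h N + wz_sum x h (Suc N) = \<kappa> * L - q 0"
    by (rule sums_unique2[rotated])
  also have "\<dots> = \<kappa> * (L - h 0 * (x - real N) * wz_factor N x)"
    by (simp add: q_def algebra_simps)
  finally show ?thesis
    unfolding \<kappa>_def .
qed

end

text \<open>With \<open>u n = (-1) ^ n * v n\<close> the n-th term is
  \<open>u n - u (n + 1)\<close>.\<close>

lemma alternating_telescope_sums:
  fixes v :: "nat \<Rightarrow> real"
  assumes "v \<longlonglongrightarrow> 0"
  shows "(\<lambda>n. (- 1) ^ n * (v n + v (Suc n))) sums v 0"
proof -
  have "(\<lambda>n. (- 1) ^ n * v n) \<longlonglongrightarrow> 0"
    using assms by (intro tendsto_rabs_zero_cancel[where f = "\<lambda>n. (- 1) ^ n * v n"])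
      (simp add: abs_mult power_abs tendsto_rabs_zero)
  from telescope_sums'[OF this] show ?thesis
    by (simp add: algebra_simps)
qed

text \<open>Both series are rows 0 with the same limit \<open>L = pi\<close>, so the boundary terms
  at infinity cancel in the difference \<open>v\<close>. The remaining lower boundary of the second
  array gives \<open>2 * (-1) ^ N / (N + 1/2) ^ 3\<close> for
  \<open>v N + v (N + 1)\<close>.\<close>

lemma half_coeff_sq_series_diff:
  obtains S T where
    "(\<lambda>b. (half_coeff b)\<^sup>2 / (real b + 1/2)) sums S"
    "(\<lambda>a. 1 / ((real (Suc a)) ^ 3 * (half_coeff (Suc a))\<^sup>2)) sums T"
    "pi\<^sup>2 * S - T = 14 * zeta 3"
proof -
  \<comment> \<open>The factor \<open>pi^2\<close> gives \<open>h1\<close> the same limit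
    \<open>L\<close> as \<open>h2\<close>.\<close>
  define h1 where "h1 b = pi\<^sup>2 * (half_coeff b)\<^sup>2" for b
  define h2 where "h2 a = 1 / ((real (Suc a))\<^sup>2 * (half_coeff (Suc a))\<^sup>2)" for a
  have step1: "h1 (Suc m) = h1 m * ((0 + real m + 1/2) / (0 + real m + 1))\<^sup>2" for m
    by (simp add: h1_def half_coeff_Suc power_mult_distrib power_divide)
  have bound1: "h1 m \<le> pi\<^sup>2 / (real m + 1)" for m
    using mult_left_mono[OF half_coeff_sq_le[of m], of "pi\<^sup>2"] by (simp add: h1_def)
  have lim1: "(\<lambda>m. real m * h1 m) \<longlonglongrightarrow> pi"
    using tendsto_mult_left[OF half_coeff_wallis, of "pi\<^sup>2"]
    by (simp add: h1_def power2_eq_square mult_ac)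
  have step2: "h2 (Suc m) = h2 m * ((1/2 + real m + 1/2) / (1/2 + real m + 1))\<^sup>2" for m
  proof -
    have "real (Suc (Suc m)) * half_coeff (Suc (Suc m)) = (real (Suc m) + 1/2) * half_coeff (Suc m)"
      using Suc_times_half_coeff_Suc[of "Suc m"] by (simp add: add.commute)
    hence "h2 (Suc m) = 1 / ((real (Suc m) + 1/2) * half_coeff (Suc m))\<^sup>2"
      by (simp add: h2_def power_mult_distrib[symmetric] del: of_nat_Suc)
    also have "\<dots> = h2 m * (real (Suc m) / (real (Suc m) + 1/2))\<^sup>2"
      by (simp add: h2_def power_mult_distrib power_divide del: of_nat_Suc)
    finally show ?thesis
      by (simp add: add_ac)
  qed
  have bound2: "h2 m \<le> 4 / (real m + 1)" for m
  proof -
    have "(real m + 1) / 4 \<le> (real m + 1)\<^sup>2 * (half_coeff (Suc m))\<^sup>2"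
    proof -
      have "(real m + 1) / 4 = (real m + 1)\<^sup>2 * (1 / (4 * (real m + 1)))"
        by (simp add: field_simps power2_eq_square)
      also have "\<dots> \<le> (real m + 1)\<^sup>2 * (half_coeff (Suc m))\<^sup>2"
        by (intro mult_left_mono half_coeff_sq_ge) auto
      finally show ?thesis .
    qed
    hence "h2 m \<le> 1 / ((real m + 1) / 4)"
      unfolding h2_def by (intro divide_left_mono) (auto simp: add.commute)
    then show ?thesis by simp
  qed
  have lim2: "(\<lambda>m. real m * h2 m) \<longlonglongrightarrow> pi"
  proof -
    have "(\<lambda>m. (1 - 1 / (real m + 1)) * (1 / (real (Suc m) * (half_coeff (Suc m))\<^sup>2))) \<longlonglongrightarrow>
        (1 - 0) * (1 / (1 / pi))"
      by (intro tendsto_mult tendsto_diff tendsto_divide tendsto_const one_over_nat_plus_tendsto_0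
          LIMSEQ_Suc[OF half_coeff_wallis]) simp
    moreover have "(1 - 1 / (real m + 1)) * (1 / (real (Suc m) * (half_coeff (Suc m))\<^sup>2)) = real m * h2 m" for m
    proof -
      have "1 - 1 / (real m + 1) = real m / real (Suc m)"
        by (simp add: field_simps)
      then show ?thesis
        by (simp add: h2_def power2_eq_square del: of_nat_Suc)
    qed
    ultimately show ?thesis by simp
  qed
  have nonneg: "h1 m \<ge> 0" "h2 m \<ge> 0" for m
    by (simp_all add: h1_def h2_def)
  note wz1 = order_refl step1 nonneg(1) bound1 lim1
  have wz2: "(0::real) \<le> 1/2" by simp
  note wz2 = wz2 step2 nonneg(2) bound2 lim2
  define v where "v N = wz_sum 0 h1 N - wz_sum (1/2) h2 N" for N
  have "(\<lambda>N. wz_sum 0 h1 N - wz_sum (1/2) h2 N) \<longlonglongrightarrow> 0 - 0"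
    by (intro tendsto_diff wz_sum_tendsto_0[OF wz1] wz_sum_tendsto_0[OF wz2])
  hence "v \<longlonglongrightarrow> 0"
    by (simp add: v_def[abs_def])
  from alternating_telescope_sums[OF this]
  have "(\<lambda>N. (- 1) ^ N * (v N + v (Suc N))) sums v 0" .
  moreover have "(- 1) ^ N * (v N + v (Suc N)) = 2 * (1 / (real N + 1/2) ^ 3)" for N
  proof -
    have "h2 0 = 4"
      by (simp add: h2_def half_coeff_Suc power2_eq_square)
    hence "h2 0 * (1/2 - real N) * wz_factor N (1/2) = 4 * (wz_factor N (1/2) * (1/2 - real N))"
      by (simp only: mult_ac)
    hence "h2 0 * (1/2 - real N) * wz_factor N (1/2) = (- 1) ^ N / (real N + 1/2)"
      unfolding wz_factor_one_half by (simp only: times_divide_eq_right) (simp add: field_simps)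
    hence "wz_sum (1/2) h2 N + wz_sum (1/2) h2 (Suc N) =
        2 / (real N + 1/2)\<^sup>2 * (pi - (- 1) ^ N / (real N + 1/2))"
      using wz_sum_rec[OF wz2, of N] by (simp only:)
    \<comment> \<open>For \<open>N = 0\<close> the middle factor is 0, and for \<open>N > 0\<close>
      the product contains the zero factor \<open>j = 0\<close>.\<close>
    moreover have "h1 0 * (0 - real N) * wz_factor N 0 = 0"
      by (cases N) (auto simp: wz_factor_def intro!: bexI[of _ 0])
    hence "wz_sum 0 h1 N + wz_sum 0 h1 (Suc N) = 2 / (real N + 1/2)\<^sup>2 * pi"
      using wz_sum_rec[OF wz1, of N] by (simp only: diff_zero)
    ultimately have "v N + v (Suc N) =
       2 / (real N + 1/2)\<^sup>2 * pi - 2 / (real N + 1/2)\<^sup>2 * (pi - (- 1) ^ N / (real N + 1/2))"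
      unfolding v_def by linarith
    also have "\<dots> = 2 / (real N + 1/2)\<^sup>2 * ((- 1) ^ N / (real N + 1/2))"
      by (simp only: right_diff_distrib diff_diff_eq2 add_diff_cancel_left')
    also have "(- 1) ^ N * \<dots> = ((- 1) ^ N * (- 1) ^ N) * (2 * (1 / (real N + 1/2) ^ 3))"
      by (simp add: power2_eq_square power3_eq_cube)
    finally show ?thesis
      by (simp add: power_mult_distrib[symmetric])
  qed
  ultimately have "(\<lambda>N. 2 * (1 / (real N + 1/2) ^ 3)) sums v 0"
    by simp
  moreover have "(\<lambda>N. 2 * (1 / (real N + 1/2) ^ 3)) sums (2 * (7 * zeta 3))"
    using sums_mult[OF half_odd_power_sums[of 3], of 2] by simp
  ultimately have v: "v 0 = 14 * zeta 3"
    by (auto dest: sums_unique2)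
  show ?thesis
  proof (rule that)
    have "(\<lambda>b. 1 / pi\<^sup>2 * (h1 b / (0 + real b + 1/2) * wz_factor 0 (0 + real b))) sums
        (1 / pi\<^sup>2 * wz_sum 0 h1 0)"
      by (intro sums_mult wz_sum_sums[OF wz1])
    then show "(\<lambda>b. (half_coeff b)\<^sup>2 / (real b + 1/2)) sums (1 / pi\<^sup>2 * wz_sum 0 h1 0)"
      by (simp add: h1_def)
    show "(\<lambda>a. 1 / ((real (Suc a)) ^ 3 * (half_coeff (Suc a))\<^sup>2)) sums wz_sum (1/2) h2 0"
    proof -
      have "h2 a / (1/2 + real a + 1/2) * wz_factor 0 (1/2 + real a) =
          1 / ((real (Suc a)) ^ 3 * (half_coeff (Suc a))\<^sup>2)" for a
        by (simp add: h2_def power2_eq_square power3_eq_cube mult_ac add_ac)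
      with wz_sum_sums[OF wz2, of 0] show ?thesis
        by (simp only:)
    qed
    show "pi\<^sup>2 * (1 / pi\<^sup>2 * wz_sum 0 h1 0) - wz_sum (1/2) h2 0 = 14 * zeta 3"
      using v by (simp add: v_def)
  qed
qed

subsection \<open>The multiple sums\<close>

lemma has_sum_diff:
  fixes f g :: "'a \<Rightarrow> real"
  assumes "(f has_sum a) A" "(g has_sum b) A"
  shows "((\<lambda>x. f x - g x) has_sum (a - b)) A"
  using has_sum_add[OF assms(1) has_sum_uminusI[OF assms(2)]] by simp

lemma has_sum_product_nonneg:
  fixes f g :: "'a \<Rightarrow> real"
  assumes "(f has_sum A) UNIV" "(g has_sum B) UNIV" "\<And>x. f x \<ge> 0" "\<And>x. g x \<ge> 0"
  shows "((\<lambda>(x, y). f x * g y) has_sum (A * B)) UNIV"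
proof -
  have inner: "((\<lambda>y. (\<lambda>(x, y). f x * g y) (x, y)) has_sum (f x * B)) UNIV" for x
    using has_sum_cmult_right[OF assms(2), of "f x"] by simp
  have outer: "((\<lambda>x. f x * B) has_sum (A * B)) UNIV"
    by (rule has_sum_cmult_left[OF assms(1)])
  have "(\<lambda>(x, y). f x * g y) summable_on (UNIV \<times> UNIV)"
    by (rule summable_on_SigmaI[OF inner]) (use outer assms in \<open>auto simp: summable_on_def\<close>)
  from has_sum_SigmaI[OF inner outer this] show ?thesis by simp
qed

text \<open>The weight \<open>w\<close> may change sign, so joint summability is shown for absolute
  values: nonnegative \<open>f\<close> and \<open>g\<close> give their inner sums, and real
  summability of the outer sum is already absolute.\<close>

lemma has_sum_four_fold:
  fixes w A B :: "nat \<Rightarrow> nat \<Rightarrow> real" and f g :: "nat \<Rightarrow> nat \<Rightarrow> nat \<Rightarrow> real"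
  assumes f: "\<And>a b. (f a b has_sum A a b) UNIV" "\<And>a b k. f a b k \<ge> 0"
    and g: "\<And>a b. (g a b has_sum B a b) UNIV" "\<And>a b k. g a b k \<ge> 0"
    and S: "((\<lambda>(a, b). w a b * (A a b * B a b)) has_sum S) UNIV"
  shows "((\<lambda>(k1, k2, a, b). w a b * (f a b k1 * g a b k2)) has_sum S) UNIV"
proof -
  define F where "F = (\<lambda>((a, b), (k1, k2)). w a b * (f a b k1 * g a b k2))"
  have prod: "((\<lambda>(k1, k2). f a b k1 * g a b k2) has_sum (A a b * B a b)) UNIV" for a b
    by (rule has_sum_product_nonneg) (use f g in auto)
  have inner: "((\<lambda>k. F (p, k)) has_sum (\<lambda>(a, b). w a b * (A a b * B a b)) p) UNIV" for p
    using has_sum_cmult_right[OF prod, of "w (fst p) (snd p)" "fst p" "snd p"]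
    by (simp add: F_def case_prod_unfold)
  have inner_abs: "((\<lambda>k. \<bar>F (p, k)\<bar>) has_sum \<bar>(\<lambda>(a, b). w a b * (A a b * B a b)) p\<bar>) UNIV" for p
  proof -
    have "A a b \<ge> 0" for a b
      by (rule has_sum_nonneg[OF f(1)]) (rule f(2))
    moreover have "B a b \<ge> 0" for a b
      by (rule has_sum_nonneg[OF g(1)]) (rule g(2))
    ultimately show ?thesis
      using has_sum_cmult_right[OF prod, of "\<bar>w (fst p) (snd p)\<bar>" "fst p" "snd p"] f(2) g(2)
      by (simp add: F_def case_prod_unfold abs_mult)
  qed
  have "(\<lambda>p. \<bar>(\<lambda>(a, b). w a b * (A a b * B a b)) p\<bar>) summable_on UNIV"
    using S summable_on_iff_abs_summable_on_real by (auto simp: summable_on_def)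
  hence "(\<lambda>q. \<bar>F q\<bar>) summable_on (UNIV \<times> UNIV)"
    by (intro summable_on_SigmaI[OF inner_abs]) auto
  hence "F summable_on (UNIV \<times> UNIV)"
    by (simp add: summable_on_iff_abs_summable_on_real[of F])
  with has_sum_SigmaI[OF inner S] have "(F has_sum S) UNIV"
    by simp
  also have "?this \<longleftrightarrow> ?thesis"
    by (rule has_sum_reindex_bij_witness[where j = "\<lambda>((a, b), (k1, k2)). (k1, k2, a, b)"
          and i = "\<lambda>(k1, k2, a, b). ((a, b), (k1, k2))"]) (auto simp: F_def)
  finally show ?thesis .
qed

text \<open>Used to add the corrections that arise only for \<open>a = 0\<close>.\<close>

lemma has_sum_row_0:
  fixes f :: "nat \<Rightarrow> real"
  assumes "(f has_sum S) UNIV"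
  shows "((\<lambda>(a, b). if a = 0 then f b else 0) has_sum S) (UNIV :: (nat \<times> nat) set)"
proof -
  have "((\<lambda>(a, b). if a = 0 then f b else 0) has_sum S) (UNIV :: (nat \<times> nat) set) \<longleftrightarrow>
      ((\<lambda>(a, b). f b) has_sum S) ((\<lambda>b. (0::nat, b)) ` UNIV)"
    by (rule has_sum_cong_neutral) auto
  also have "\<dots> \<longleftrightarrow> (f has_sum S) UNIV"
    by (subst has_sum_reindex) (auto simp: inj_on_def o_def)
  finally show ?thesis
    using assms by simp
qed

lemma half_coeff_le_1: "half_coeff k \<le> 1"
proof (rule power2_le_imp_le)
  have "(half_coeff k)\<^sup>2 \<le> 1 / (real k + 1)"
    by (rule half_coeff_sq_le)
  also have "\<dots> \<le> 1\<^sup>2"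
    by simp
  finally show "(half_coeff k)\<^sup>2 \<le> 1\<^sup>2" .
qed simp

section \<open>Single sums by partial fractions\<close>

lemma half_coeff_over_sums:
  assumes "z > 0"
  shows "(\<lambda>k. half_coeff k / ((real k + z) * real k)) sums ((gamma1 - hsum 1 z + 1 / z) / z)"
proof -
  \<comment> \<open>The term \<open>k = 0\<close> counts as 0 in the target and in
    \<open>hsum 1 0\<close>, but contributes \<open>1 / z\<close> to \<open>hsum 1 z\<close>; this
    series compensates.\<close>
  have "(\<lambda>k. (if k = 0 then 1 / z else 0)) sums (1 / z)"
    using sums_If_finite_set[of "{0::nat}" "\<lambda>_. 1 / z"] by simp
  with hsum_1_sums[of 0] hsum_1_sums[of z]
  have "(\<lambda>k. (half_coeff k / (real k + 0) - half_coeff k / (real k + z) + (if k = 0 then 1 / z else 0)) / z)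
      sums ((hsum 1 0 - hsum 1 z + 1 / z) / z)"
    by (intro sums_divide sums_add sums_diff) auto
  moreover have "(half_coeff k / (real k + 0) - half_coeff k / (real k + z) + (if k = 0 then 1 / z else 0)) / z
      = half_coeff k / ((real k + z) * real k)" for k
  proof (cases "k = 0")
    case False
    hence "real k \<noteq> 0" "real k + z \<noteq> 0" "z \<noteq> 0"
      using assms by auto
    then show ?thesis
      using False by (simp add: divide_simps) (simp add: algebra_simps)
  qed (use assms in auto)
  ultimately show ?thesis
    by (simp add: hsum_0(1)[simplified])
qed

lemma half_coeff_over_sq_sums:
  assumes "z > 0"
  shows "(\<lambda>k. half_coeff k / ((real k)\<^sup>2 * (real k + z))) sums
           ((zeta 2 - gamma1\<^sup>2 / 2 - (gamma1 - hsum 1 z + 1 / z) / z) / z)"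
proof -
  have "(\<lambda>k. (half_coeff k / (real k + 0) ^ 2 - half_coeff k / ((real k + z) * real k)) / z) sums
      ((hsum 2 0 - (gamma1 - hsum 1 z + 1 / z) / z) / z)"
    by (intro sums_divide sums_diff hsum_sums half_coeff_over_sums assms) simp
  moreover have "(half_coeff k / (real k + 0) ^ 2 - half_coeff k / ((real k + z) * real k)) / z =
      half_coeff k / ((real k)\<^sup>2 * (real k + z))" for k
  proof (cases "k = 0")
    case False
    hence "real k \<noteq> 0" "real k + z \<noteq> 0" "z \<noteq> 0"
      using assms by auto
    then show ?thesis
      by (simp add: divide_simps power2_eq_square) (simp add: algebra_simps)
  qed simp
  ultimately show ?thesis
    by (simp add: hsum_0(2))
qed

text \<open>The value of the sum over \<open>k1\<close> that \<open>nu\<close> and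
  \<open>nu'\<close> share. The row \<open>a = 0\<close> differs because \<open>a + k1\<close>
  vanishes there at \<open>k1 = 0\<close>.\<close>

definition inner_sum :: "nat \<Rightarrow> nat \<Rightarrow> real" where
  "inner_sum a b =
     (if a = 0 then (gamma1 - pi * half_coeff b + 1 / (real b + 1/2)) / (real b + 1/2)
      else (1 / (real a * half_coeff a) - pi * half_coeff b) / (real b - real a + 1/2))"

lemma half_diff_neq_0: "real b - real a + 1/2 \<noteq> 0"
  using half_int_neq_0[of b a] by (simp add: algebra_simps)

lemma inner_sum_has_sum:
  "((\<lambda>k. half_coeff k / ((real b + real k + 1/2) * (real a + real k))) has_sum inner_sum a b) UNIV"
proof (rule sums_nonneg_imp_has_sum)
  show "(\<lambda>k. half_coeff k / ((real b + real k + 1/2) * (real a + real k))) sums inner_sum a b"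
  proof (cases a)
    case 0
    show ?thesis
      using half_coeff_over_sums[of "real b + 1/2"] unfolding hsum_1_half
      by (simp add: inner_sum_def 0 add_ac)
  next
    case (Suc a')
    have "(\<lambda>k. (half_coeff k / (real k + real a) - half_coeff k / (real k + (real b + 1/2)))
        / (real b - real a + 1/2)) sums ((hsum 1 (real a) - hsum 1 (real b + 1/2)) / (real b - real a + 1/2))"
      by (intro sums_divide sums_diff hsum_1_sums)
    moreover have "(half_coeff k / (real k + real a) - half_coeff k / (real k + (real b + 1/2)))
        / (real b - real a + 1/2) = half_coeff k / ((real b + real k + 1/2) * (real a + real k))" for k
    proof -
      have eq: "(c / x - c / y) / (y - x) = c / (y * x)"
        if "x \<noteq> 0" "y \<noteq> 0" "y - x \<noteq> 0" for c x y :: real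
        using that by (simp add: field_simps)
      have "real k + real a \<noteq> 0" "real k + (real b + 1/2) \<noteq> 0"
        using Suc by (auto simp: add_nonneg_eq_0_iff)
      moreover have diff: "real k + (real b + 1/2) - (real k + real a) = real b - real a + 1/2"
        by simp
      ultimately show ?thesis
        using eq[of "real k + real a" "real k + (real b + 1/2)" "half_coeff k"] half_diff_neq_0[of b a]
        unfolding diff by (simp add: add_ac)
    qed
    ultimately show ?thesis
      using hsum_1_nat[of a'] by (simp add: inner_sum_def hsum_1_half[simplified] Suc)
  qed
qed (auto intro!: divide_nonneg_nonneg mult_nonneg_nonneg)

text \<open>The value of the sum over \<open>k2\<close> in \<open>nu\<close>, with
  \<open>half_coeff a\<close> absorbed since it cancels for \<open>a > 0\<close>.\<close>

definition outer_sum :: "nat \<Rightarrow> real" where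
  "outer_sum a = (if a = 0 then gamma1 else 1 / real a)"

lemma outer_sum_has_sum:
  "((\<lambda>k. half_coeff a * half_coeff k / (real a + real k)) has_sum outer_sum a) UNIV"
proof (rule sums_nonneg_imp_has_sum)
  have "half_coeff a * hsum 1 (real a) = outer_sum a"
    using hsum_1_nat[of "a - 1"] by (cases a) (auto simp: outer_sum_def hsum_0(1)[simplified])
  with sums_mult[OF hsum_1_sums[of "real a"], of "half_coeff a"]
  show "(\<lambda>k. half_coeff a * half_coeff k / (real a + real k)) sums outer_sum a"
    by (simp add: add.commute)
qed auto

lemma hsum_1_half_has_sum:
  "((\<lambda>k. half_coeff k / (real b + real k + 1/2)) has_sum (pi * half_coeff b)) UNIV"
proof (rule sums_nonneg_imp_has_sum)
  show "(\<lambda>k. half_coeff k / (real b + real k + 1/2)) sums (pi * half_coeff b)"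
    using hsum_1_sums[of "real b + 1/2"] unfolding hsum_1_half by (simp add: add_ac)
qed auto

lemma half_coeff_power_has_sum:
  assumes "n \<ge> 1"
  shows "((\<lambda>b. half_coeff b / (real b + 1/2) ^ n) has_sum hsum n (1/2)) UNIV"
  by (intro sums_nonneg_imp_has_sum hsum_sums assms) auto

text \<open>The sums for \<open>n = 2\<close> and \<open>n = 3\<close> enter the final computation
  as unknowns that cancel.\<close>

lemma half_coeff_sq_power_summable_on:
  assumes "n \<ge> 1"
  shows "(\<lambda>b. (half_coeff b)\<^sup>2 / (real b + 1/2) ^ n) summable_on UNIV"
proof (rule summable_on_comparison_test)
  show "(\<lambda>b. half_coeff b / (real b + 1/2) ^ n) summable_on UNIV"
    using half_coeff_power_has_sum[OF assms] by (auto simp: summable_on_def)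
  show "(half_coeff b)\<^sup>2 / (real b + 1/2) ^ n \<le> half_coeff b / (real b + 1/2) ^ n" for b
    using half_coeff_le_1[of b]
    by (intro divide_right_mono) (auto simp: power2_eq_square mult_left_le)
qed auto

section \<open>Double series with squared denominators\<close>

text \<open>For \<open>a > 0\<close>, summing out \<open>k1\<close> and \<open>k2\<close> turns the summand of \<open>nu\<close> into
  \<open>diag_a - diag_mid\<close> and that of \<open>nu'\<close> into \<open>diag_mid - pi\<^sup>2 * diag_b\<close>, so \<open>diag_mid\<close> cancels.\<close>

definition diag_a :: "nat \<times> nat \<Rightarrow> real" where
  "diag_a = (\<lambda>(a, b). half_coeff b / ((real a)\<^sup>2 * half_coeff a * (real b - real a + 1/2)\<^sup>2))"

definition diag_b :: "nat \<times> nat \<Rightarrow> real" where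
  "diag_b = (\<lambda>(a, b). half_coeff a * (half_coeff b) ^ 3 / (real b - real a + 1/2)\<^sup>2)"

definition diag_mid :: "nat \<times> nat \<Rightarrow> real" where
  "diag_mid = (\<lambda>(a, b). pi * (half_coeff b)\<^sup>2 / (real a * (real b - real a + 1/2)\<^sup>2))"

text \<open>Summing over \<open>b\<close> first gives \<open>hsum 2\<close> at
  \<open>1/2 - a\<close>, which has a closed form. The row \<open>a = 0\<close> is 0 by division by
  zero.\<close>

lemma diag_a_has_sum:
  assumes "(\<lambda>a. 1 / ((real (Suc a)) ^ 3 * (half_coeff (Suc a))\<^sup>2)) sums T"
  shows "(diag_a has_sum (pi * T)) UNIV"
proof -
  define g where "g a = pi * (1 / (real a ^ 3 * (half_coeff a)\<^sup>2))" for a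
  have inner: "((\<lambda>b. diag_a (a, b)) has_sum g a) UNIV" for a
  proof (rule sums_nonneg_imp_has_sum)
    show "(\<lambda>b. diag_a (a, b)) sums g a"
    proof (cases a)
      case 0
      then show ?thesis by (simp add: diag_a_def g_def)
    next
      case (Suc a')
      have "(\<lambda>b. 1 / ((real a)\<^sup>2 * half_coeff a) * (half_coeff b / (real b + (1/2 - real a))\<^sup>2)) sums
          (1 / ((real a)\<^sup>2 * half_coeff a) * hsum 2 (1/2 - real a))"
        by (intro sums_mult hsum_sums) simp
      moreover have "1 / ((real a)\<^sup>2 * half_coeff a) * hsum 2 (1/2 - real a) = g a"
        unfolding Suc hsum_2_neg_half g_def by (simp add: power2_eq_square power3_eq_cube)
      ultimately show ?thesis
        by (simp add: diag_a_def algebra_simps)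
    qed
  qed (auto simp: diag_a_def)
  have "(\<lambda>a. g (Suc a)) sums (pi * T)"
    unfolding g_def by (intro sums_mult assms)
  moreover have "g 0 = 0"
    by (simp add: g_def)
  ultimately have "g sums (pi * T)"
    by (simp add: sums_Suc_iff)
  hence outer: "(g has_sum (pi * T)) UNIV"
    by (intro sums_nonneg_imp_has_sum) (auto simp: g_def)
  have "diag_a summable_on (UNIV \<times> UNIV)"
    by (rule summable_on_SigmaI[OF inner]) (use outer in \<open>auto simp: summable_on_def diag_a_def\<close>)
  from has_sum_SigmaI[OF inner outer this] show ?thesis
    by simp
qed

lemma has_sum_swap_pairs:
  fixes f :: "nat \<times> nat \<Rightarrow> real"
  assumes inner: "\<And>b. (\<lambda>a. f (a, b)) sums g b" and outer: "(g has_sum S) UNIV"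
    and nonneg: "\<And>p. f p \<ge> 0"
  shows "(f has_sum S) UNIV"
proof -
  have inner': "((\<lambda>a. (\<lambda>(b, a). f (a, b)) (b, a)) has_sum g b) UNIV" for b
    using inner nonneg by (auto intro: sums_nonneg_imp_has_sum)
  have "(\<lambda>(b, a). f (a, b)) summable_on (UNIV \<times> UNIV)"
    by (rule summable_on_SigmaI[OF inner']) (use outer nonneg in \<open>auto simp: summable_on_def\<close>)
  from has_sum_SigmaI[OF inner' outer this]
  have "((\<lambda>(b, a). f (a, b)) has_sum S) UNIV"
    by simp
  also have "?this \<longleftrightarrow> ?thesis"
    by (rule has_sum_reindex_bij_witness[where i = prod.swap and j = prod.swap]) auto
  finally show ?thesis .
qed

text \<open>Summing over \<open>a\<close> first, the square is that of
  \<open>a + (1/2 - (b + 1))\<close>, so \<open>hsum_2_neg_half\<close> applies with index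
  \<open>b + 1\<close>.\<close>

lemma diag_b_has_sum:
  assumes "(\<lambda>b. (half_coeff b)\<^sup>2 / (real b + 1/2)) sums S"
  shows "(diag_b has_sum (pi * S)) UNIV"
proof (rule has_sum_swap_pairs)
  show "((\<lambda>b. pi * ((half_coeff b)\<^sup>2 / (real b + 1/2))) has_sum (pi * S)) UNIV"
    by (intro has_sum_cmult_right sums_nonneg_imp_has_sum assms) auto
  fix b
  have "(\<lambda>a. (half_coeff b) ^ 3 * (half_coeff a / (real a + (1/2 - real (Suc b)))\<^sup>2)) sums
      ((half_coeff b) ^ 3 * hsum 2 (1/2 - real (Suc b)))"
    by (intro sums_mult hsum_sums) simp
  moreover have "real (Suc b) * half_coeff (Suc b) = (real b + 1/2) * half_coeff b"
    using Suc_times_half_coeff_Suc[of b] by (simp add: add.commute)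
  hence "(half_coeff b) ^ 3 * hsum 2 (1/2 - real (Suc b)) = pi * ((half_coeff b)\<^sup>2 / (real b + 1/2))"
    unfolding hsum_2_neg_half by (simp only:) (simp add: power2_eq_square power3_eq_cube)
  moreover have "(half_coeff b) ^ 3 * (half_coeff a / (real a + (1/2 - real (Suc b)))\<^sup>2) = diag_b (a, b)" for a
  proof -
    have "(real a + (1/2 - real (Suc b)))\<^sup>2 = (real b - real a + 1/2)\<^sup>2"
      by (simp add: power2_eq_square algebra_simps)
    then show ?thesis
      by (simp only: diag_b_def) simp
  qed
  ultimately show "(\<lambda>a. diag_b (a, b)) sums (pi * ((half_coeff b)\<^sup>2 / (real b + 1/2)))"
    by simp
qed (auto simp: diag_b_def)

lemma diag_mid_nonneg: "diag_mid p \<ge> 0"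
  by (auto simp: diag_mid_def split: prod.splits)

text \<open>Expanding the square of \<open>1 / a - pi * half_coeff a * half_coeff b\<close>,
  weighted by \<open>half_coeff b / half_coeff a\<close>, bounds twice the middle term. This makes
  \<open>diag_mid\<close> summable, so that cancelling its sum is legitimate.\<close>

lemma diag_mid_le: "diag_mid p \<le> diag_a p + pi\<^sup>2 * diag_b p"
proof (cases p)
  case (Pair a b)
  define d where "d = (real b - real a + 1/2)\<^sup>2"
  have d: "d > 0"
    using half_diff_neq_0[of b a] by (simp add: d_def)
  show ?thesis
  proof (cases "a = 0")
    case True
    then show ?thesis by (simp add: Pair diag_mid_def diag_a_def diag_b_def)
  next
    case False
    have mid: "diag_mid p = (pi * (half_coeff b)\<^sup>2 / real a) / d"
      by (simp add: Pair diag_mid_def d_def)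
    have sum: "diag_a p + pi\<^sup>2 * diag_b p =
        (half_coeff b / ((real a)\<^sup>2 * half_coeff a) + pi\<^sup>2 * (half_coeff a * (half_coeff b) ^ 3)) / d"
      by (simp add: Pair diag_a_def diag_b_def d_def add_divide_distrib)
    have "0 \<le> half_coeff b / half_coeff a * (1 / real a - pi * half_coeff a * half_coeff b)\<^sup>2"
      by simp
    also have "\<dots> = half_coeff b / ((real a)\<^sup>2 * half_coeff a) + pi\<^sup>2 * (half_coeff a * (half_coeff b) ^ 3)
        - 2 * (pi * (half_coeff b)\<^sup>2 / real a)"
      using False by (simp add: field_simps power2_eq_square power3_eq_cube)
    finally have "0 \<le> half_coeff b / ((real a)\<^sup>2 * half_coeff a) + pi\<^sup>2 * (half_coeff a * (half_coeff b) ^ 3)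
        - 2 * (pi * (half_coeff b)\<^sup>2 / real a)" .
    moreover have "pi * (half_coeff b)\<^sup>2 / real a \<ge> 0"
      by simp
    ultimately have "pi * (half_coeff b)\<^sup>2 / real a \<le>
        half_coeff b / ((real a)\<^sup>2 * half_coeff a) + pi\<^sup>2 * (half_coeff a * (half_coeff b) ^ 3)"
      by linarith
    then show ?thesis
      unfolding mid sum using d by (intro divide_right_mono) auto
  qed
qed

text \<open>For \<open>a = 0\<close> both \<open>diag_a\<close> and \<open>diag_mid\<close> are 0 by
  division by zero, so the conditional carries the whole value.\<close>

lemma nu_weight_eq:
  "half_coeff b / (real b - real a + 1/2) * (inner_sum a b * outer_sum a) =
     diag_a (a, b) - diag_mid (a, b) + (if a = 0 then
       gamma1\<^sup>2 * (half_coeff b / (real b + 1/2)\<^sup>2) - pi * gamma1 * ((half_coeff b)\<^sup>2 / (real b + 1/2)\<^sup>2)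
       + gamma1 * (half_coeff b / (real b + 1/2) ^ 3) else 0)"
proof (cases "a = 0")
  case True
  have *: "c / B * ((g - pi * c + 1 / B) / B * g) = g\<^sup>2 * (c / B\<^sup>2) - pi * g * (c\<^sup>2 / B\<^sup>2) + g * (c / B ^ 3)"
    if "B \<noteq> 0" for c B g :: real
    using that by (simp add: field_simps power2_eq_square power3_eq_cube)
  show ?thesis
    using *[of "real b + 1/2" "half_coeff b" gamma1] True
    by (simp add: inner_sum_def outer_sum_def diag_a_def diag_mid_def add_nonneg_eq_0_iff)
next
  case False
  have *: "c / d * ((1 / (x * e) - pi * c) / d * (1 / x)) = c / (x\<^sup>2 * e * d\<^sup>2) - pi * c\<^sup>2 / (x * d\<^sup>2)"
    if "x \<noteq> 0" "d \<noteq> 0" "e \<noteq> 0" for c d e x :: real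
    using that by (simp add: field_simps power2_eq_square)
  show ?thesis
    using *[OF _ half_diff_neq_0[of b a] half_coeff_neq_0[of a], of "real a" "half_coeff b"] False
    by (simp add: inner_sum_def outer_sum_def diag_a_def diag_mid_def)
qed

text \<open>For \<open>a = 0\<close> only \<open>diag_mid\<close> is 0; the \<open>diag_b\<close>
  term accounts for the cubic part, and the conditional for the rest.\<close>

lemma nu'_weight_eq:
  "half_coeff a * half_coeff b / (real b - real a + 1/2) * (inner_sum a b * (pi * half_coeff b)) =
     diag_mid (a, b) - pi\<^sup>2 * diag_b (a, b) + (if a = 0 then
       pi * gamma1 * ((half_coeff b)\<^sup>2 / (real b + 1/2)\<^sup>2) + pi * ((half_coeff b)\<^sup>2 / (real b + 1/2) ^ 3)
       else 0)"
proof (cases "a = 0")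
  case True
  have *: "c / B * ((g - pi * c + 1 / B) / B * (pi * c)) =
      pi * g * (c\<^sup>2 / B\<^sup>2) + pi * (c\<^sup>2 / B ^ 3) - pi\<^sup>2 * (c ^ 3 / B\<^sup>2)"
    if "B \<noteq> 0" for c B g :: real
    using that by (simp add: field_simps power2_eq_square power3_eq_cube)
  show ?thesis
    using *[of "real b + 1/2" "half_coeff b" gamma1] True
    by (simp add: inner_sum_def diag_b_def diag_mid_def add_nonneg_eq_0_iff)
next
  case False
  have *: "e * c / d * ((1 / (x * e) - pi * c) / d * (pi * c)) =
      pi * c\<^sup>2 / (x * d\<^sup>2) - pi\<^sup>2 * (e * c ^ 3 / d\<^sup>2)"
    if "x \<noteq> 0" "d \<noteq> 0" "e \<noteq> 0" for c d e x :: real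
    using that by (simp add: field_simps power2_eq_square power3_eq_cube)
  show ?thesis
    using *[OF _ half_diff_neq_0[of b a] half_coeff_neq_0[of a], of "real a" "half_coeff b"] False
    by (simp add: inner_sum_def diag_b_def diag_mid_def)
qed

text \<open>Since \<open>x / 0 = 0\<close>, a primed sum may be taken over all tuples.\<close>

lemma has_sum_div_nonzero_iff:
  fixes c d :: "'a \<Rightarrow> real"
  shows "((\<lambda>t. c t / d t) has_sum S) {t. d t \<noteq> 0} \<longleftrightarrow> ((\<lambda>t. c t / d t) has_sum S) UNIV"
  by (rule has_sum_cong_neutral) auto

text \<open>The summability claims ensure that the three constants are genuine sums and not the
  default value 0 of \<open>infsum\<close>.\<close>

theorem lemma5p5:
  shows "(\<lambda>t. coeff4 t / nu_denom t) summable_on {t. nu_denom t \<noteq> 0} \<and>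
         (\<lambda>t. coeff4 t / nu'_denom t) summable_on {t. nu'_denom t \<noteq> 0} \<and>
         (\<lambda>t. coeff2 t / psi_denom t) summable_on {t. psi_denom t \<noteq> 0} \<and>
         nu + nu' - psi = 8/3 * gamma1 ^ 3 + 2 * gamma1 * zeta 2 - 12 * zeta 3"
proof -
  obtain S T where S: "(\<lambda>b. (half_coeff b)\<^sup>2 / (real b + 1/2)) sums S"
    and T: "(\<lambda>a. 1 / ((real (Suc a)) ^ 3 * (half_coeff (Suc a))\<^sup>2)) sums T"
    and ST: "pi\<^sup>2 * S - T = 14 * zeta 3"
    by (rule half_coeff_sq_series_diff)
  obtain W2 W3 where W2: "((\<lambda>b. (half_coeff b)\<^sup>2 / (real b + 1/2)\<^sup>2) has_sum W2) UNIV"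
    and W3: "((\<lambda>b. (half_coeff b)\<^sup>2 / (real b + 1/2) ^ 3) has_sum W3) UNIV"
    using half_coeff_sq_power_summable_on[of 2] half_coeff_sq_power_summable_on[of 3]
    by (auto simp: summable_on_def)
  note A = diag_a_has_sum[OF T] and B = diag_b_has_sum[OF S]
  have "diag_mid summable_on UNIV"
  proof (rule summable_on_comparison_test)
    show "(\<lambda>p. diag_a p + pi\<^sup>2 * diag_b p) summable_on UNIV"
      using has_sum_add[OF A has_sum_cmult_right[OF B, of "pi\<^sup>2"]] by (auto simp: summable_on_def)
  qed (auto intro: diag_mid_le simp: diag_mid_nonneg)
  then obtain M where M: "(diag_mid has_sum M) UNIV"
    by (auto simp: summable_on_def)
  define F2 F3 F4 where "F2 = hsum 2 (1/2)" and "F3 = hsum 3 (1/2)" and "F4 = hsum 4 (1/2)"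
  have F: "((\<lambda>b. half_coeff b / (real b + 1/2)\<^sup>2) has_sum F2) UNIV"
    "((\<lambda>b. half_coeff b / (real b + 1/2) ^ 3) has_sum F3) UNIV"
    "((\<lambda>b. half_coeff b / (real b + 1/2) ^ 4) has_sum F4) UNIV"
    unfolding F2_def F3_def F4_def by (intro half_coeff_power_has_sum; simp)+
  \<comment> \<open>\<open>M\<close> and \<open>W2\<close> cancel between \<open>N\<close> and
    \<open>N'\<close>, and \<open>W3\<close> cancels between \<open>N'\<close> and
    \<open>P\<close>.\<close>
  define N where "N = pi * T - M + (gamma1\<^sup>2 * F2 - pi * gamma1 * W2 + gamma1 * F3)"
  define N' where "N' = M - pi\<^sup>2 * (pi * S) + (pi * gamma1 * W2 + pi * W3)"
  define P where "P = (zeta 2 - gamma1\<^sup>2 / 2) * F2 - gamma1 * F3 + pi * W3 - F4"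

  have "((\<lambda>(a, b). half_coeff b / (real b - real a + 1/2) * (inner_sum a b * outer_sum a)) has_sum N) UNIV"
  proof -
    have "((\<lambda>b. gamma1\<^sup>2 * (half_coeff b / (real b + 1/2)\<^sup>2) - pi * gamma1 * ((half_coeff b)\<^sup>2 / (real b + 1/2)\<^sup>2)
       + gamma1 * (half_coeff b / (real b + 1/2) ^ 3)) has_sum
       (gamma1\<^sup>2 * F2 - pi * gamma1 * W2 + gamma1 * F3)) UNIV"
      by (intro has_sum_add has_sum_diff has_sum_cmult_right F W2)
    from has_sum_add[OF has_sum_diff[OF A M] has_sum_row_0[OF this]] show ?thesis
      unfolding nu_weight_eq N_def by (simp add: case_prod_unfold)
  qed
  from has_sum_four_fold[OF inner_sum_has_sum _ outer_sum_has_sum _ this]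
  have "((\<lambda>t. coeff4 t / nu_denom t) has_sum N) UNIV"
    by (simp add: coeff4_def nu_denom_def case_prod_unfold mult_ac)
  hence nu_sum: "((\<lambda>t. coeff4 t / nu_denom t) has_sum N) {t. nu_denom t \<noteq> 0}"
    by (simp only: has_sum_div_nonzero_iff)

  have "((\<lambda>(a, b). half_coeff a * half_coeff b / (real b - real a + 1/2) * (inner_sum a b * (pi * half_coeff b)))
      has_sum N') UNIV"
  proof -
    have "((\<lambda>b. pi * gamma1 * ((half_coeff b)\<^sup>2 / (real b + 1/2)\<^sup>2) + pi * ((half_coeff b)\<^sup>2 / (real b + 1/2) ^ 3))
       has_sum (pi * gamma1 * W2 + pi * W3)) UNIV"
      by (intro has_sum_add has_sum_cmult_right W2 W3)
    from has_sum_add[OF has_sum_diff[OF M has_sum_cmult_right[OF B, of "pi\<^sup>2"]] has_sum_row_0[OF this]]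
    show ?thesis
      unfolding nu'_weight_eq N'_def by (simp add: case_prod_unfold)
  qed
  from has_sum_four_fold[OF inner_sum_has_sum _ hsum_1_half_has_sum _ this]
  have "((\<lambda>t. coeff4 t / nu'_denom t) has_sum N') UNIV"
    by (simp add: coeff4_def nu'_denom_def case_prod_unfold mult_ac)
  hence nu'_sum: "((\<lambda>t. coeff4 t / nu'_denom t) has_sum N') {t. nu'_denom t \<noteq> 0}"
    by (simp only: has_sum_div_nonzero_iff)

  \<comment> \<open>The sum over \<open>a\<close> is done first, by partial fractions with
    \<open>z = b + 1/2\<close>.\<close>
  have "((\<lambda>t. coeff2 t / psi_denom t) has_sum P) UNIV"
  proof (rule has_sum_swap_pairs)
    show "((\<lambda>b. (zeta 2 - gamma1\<^sup>2 / 2) * (half_coeff b / (real b + 1/2)\<^sup>2)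
        - gamma1 * (half_coeff b / (real b + 1/2) ^ 3)
        + pi * ((half_coeff b)\<^sup>2 / (real b + 1/2) ^ 3) - half_coeff b / (real b + 1/2) ^ 4) has_sum P) UNIV"
      unfolding P_def by (intro has_sum_add has_sum_diff has_sum_cmult_right F W3)
    fix b
    have sums: "(\<lambda>a. half_coeff b / (real b + 1/2) * (half_coeff a / ((real a)\<^sup>2 * (real a + (real b + 1/2))))) sums
        (half_coeff b / (real b + 1/2) * ((zeta 2 - gamma1\<^sup>2 / 2
          - (gamma1 - pi * half_coeff b + 1 / (real b + 1/2)) / (real b + 1/2)) / (real b + 1/2)))"
      using half_coeff_over_sq_sums[of "real b + 1/2"] unfolding hsum_1_half by (intro sums_mult) simp
    have alg: "c / B * ((z - (g - pi * c + 1 / B) / B) / B) =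
        z * (c / B\<^sup>2) - g * (c / B ^ 3) + pi * (c\<^sup>2 / B ^ 3) - c / B ^ 4"
      if "B \<noteq> 0" for c B g z :: real
      using that by (simp add: field_simps power2_eq_square power3_eq_cube power4_eq_xxxx)
    have "half_coeff b / (real b + 1/2) * ((zeta 2 - gamma1\<^sup>2 / 2
          - (gamma1 - pi * half_coeff b + 1 / (real b + 1/2)) / (real b + 1/2)) / (real b + 1/2)) =
        (zeta 2 - gamma1\<^sup>2 / 2) * (half_coeff b / (real b + 1/2)\<^sup>2)
        - gamma1 * (half_coeff b / (real b + 1/2) ^ 3)
        + pi * ((half_coeff b)\<^sup>2 / (real b + 1/2) ^ 3) - half_coeff b / (real b + 1/2) ^ 4"
      by (rule alg) (simp add: add_nonneg_eq_0_iff)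
    moreover have "half_coeff b / (real b + 1/2) * (half_coeff a / ((real a)\<^sup>2 * (real a + (real b + 1/2)))) =
        coeff2 (a, b) / psi_denom (a, b)" for a
      by (simp add: coeff2_def psi_denom_def mult_ac add_ac)
    ultimately show "(\<lambda>a. coeff2 (a, b) / psi_denom (a, b)) sums
        ((zeta 2 - gamma1\<^sup>2 / 2) * (half_coeff b / (real b + 1/2)\<^sup>2)
        - gamma1 * (half_coeff b / (real b + 1/2) ^ 3)
        + pi * ((half_coeff b)\<^sup>2 / (real b + 1/2) ^ 3) - half_coeff b / (real b + 1/2) ^ 4)"
      using sums by (simp only:)
  qed (auto simp: coeff2_def psi_denom_def)
  hence psi_sum: "((\<lambda>t. coeff2 t / psi_denom t) has_sum P) {t. psi_denom t \<noteq> 0}"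
    by (simp only: has_sum_div_nonzero_iff)

  have "nu + nu' - psi = 1 / pi * (N + N' - P)"
    unfolding nu_def nu'_def psi_def using nu_sum nu'_sum psi_sum
    by (simp add: infsumI algebra_simps diff_divide_distrib add_divide_distrib)
  also have "N + N' - P = pi * (T - pi\<^sup>2 * S) + gamma1\<^sup>2 * F2 + 2 * gamma1 * F3
      - (zeta 2 - gamma1\<^sup>2 / 2) * F2 + F4"
    by (simp add: N_def N'_def P_def algebra_simps)
  also have "T - pi\<^sup>2 * S = - 14 * zeta 3"
    using ST by simp
  \<comment> \<open>Here \<open>F4\<close> contributes \<open>2 * zeta 3\<close>, which turns -14
    into -12.\<close>
  also have "1 / pi * (pi * (- 14 * zeta 3) + gamma1\<^sup>2 * F2 + 2 * gamma1 * F3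
      - (zeta 2 - gamma1\<^sup>2 / 2) * F2 + F4) = 8/3 * gamma1 ^ 3 + 2 * gamma1 * zeta 2 - 12 * zeta 3"
    unfolding F2_def F3_def F4_def hsum_one_half
    by (simp add: field_simps power2_eq_square power3_eq_cube)
  finally show ?thesis
    using nu_sum nu'_sum psi_sum by (auto simp: summable_on_def)
qed

end
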